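(* Let $F$ be a continuous distribution function of a positive random variable with finite mean $\overline{\tau}$ and finite second moment $\sigma^2=\int_0^\infty2s(1-F(s))\,ds<\infty$. Let $M_{tr}$ and $M_{eq}$ be the transitional and equilibrium mean square displacements associated with $F$ (with velocity second moment $v^2$). Then $$M_{tr}(t)\sim M_{eq}(t)\sim\sigma^2v^2\frac t{\overline{\tau}}\quad\text{as }t\to\infty.$$
   Context: Given $F$ with $\overline{\tau}=\int_0^\infty(1-F(s))\,ds$: let $\tau_1,\tau_2,\dots$ be i.i.d. with distribution $F$, let $T_0\ge0$ be independent of the $\tau_i$, and $T_i=T_{i-1}+\tau_i$. Let $V_0,V_1,\dots$ be i.i.d. random vectors in $\mathbb{R}^d$, independent of the times, with $E[V_i]=0$ and $E[|V_i|^2]=v^2\in(0,\infty)$. Set $V(t)=V_0$ for $0\le t<T_0$, $V(t)=V_i$ for $T_{i-1}\le t<T_i$, $X(t)=\int_0^tV(s)\,ds$, $M(t)=E[|X(t)|^2]$. $M_{tr}$ is $M$ when $T_0=0$; $M_{eq}$ is $M$ when $T_0$ has distribution function $F_0(t)=\frac1{\overline{\tau}}\int_0^t(1-F(s))\,ds$. *)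

theory Defs
  imports "HOL-Probability.Probability" "HOL-Library.Landau_Symbols"
begin

text \<open>Renewal times, 0-based: tau k plays the role of the paper's tau_(k+1);
  renewal_times T0 tau i = T_i = T0 + tau_1 + ... + tau_i.\<close>
definition renewal_times :: "('a \<Rightarrow> real) \<Rightarrow> (nat \<Rightarrow> 'a \<Rightarrow> real) \<Rightarrow> nat \<Rightarrow> 'a \<Rightarrow> real" where
  "renewal_times T0 tau i \<omega> = T0 \<omega> + (\<Sum>k<i. tau k \<omega>)"

text \<open>V(t) = V_0 for t < T_0, V_i for T_(i-1) <= t < T_i, i.e. V_i with i the least index
  such that t < T_i (0 on the null event where no such index exists).\<close>
definition velocity :: "('a \<Rightarrow> real) \<Rightarrow> (nat \<Rightarrow> 'a \<Rightarrow> real) \<Rightarrow> (nat \<Rightarrow> 'a \<Rightarrow> 'v::zero)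
    \<Rightarrow> 'a \<Rightarrow> real \<Rightarrow> 'v" where
  "velocity T0 tau V \<omega> t =
     (if \<exists>i. t < renewal_times T0 tau i \<omega>
      then V (LEAST i. t < renewal_times T0 tau i \<omega>) \<omega> else 0)"

definition displacement :: "('a \<Rightarrow> real) \<Rightarrow> (nat \<Rightarrow> 'a \<Rightarrow> real) \<Rightarrow> (nat \<Rightarrow> 'a \<Rightarrow> 'v::euclidean_space)
    \<Rightarrow> real \<Rightarrow> 'a \<Rightarrow> 'v" where
  "displacement T0 tau V t \<omega> = integral {0..t} (velocity T0 tau V \<omega>)"

definition msd :: "'a measure \<Rightarrow> ('a \<Rightarrow> real) \<Rightarrow> (nat \<Rightarrow> 'a \<Rightarrow> real) \<Rightarrow> (nat \<Rightarrow> 'a \<Rightarrow> 'v::euclidean_space)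
    \<Rightarrow> real \<Rightarrow> real" where
  "msd M T0 tau V t = integral\<^sup>L M (\<lambda>\<omega>. (norm (displacement T0 tau V t \<omega>))\<^sup>2)"

definition renewal_model :: "'a measure \<Rightarrow> (real \<Rightarrow> real) \<Rightarrow> ('a \<Rightarrow> real) \<Rightarrow> (nat \<Rightarrow> 'a \<Rightarrow> real)
    \<Rightarrow> (nat \<Rightarrow> 'a \<Rightarrow> 'v::euclidean_space) \<Rightarrow> real \<Rightarrow> bool" where
  "renewal_model M F T0 tau V v \<longleftrightarrow>
     prob_space M \<and>
     T0 \<in> borel_measurable M \<and>
     (\<forall>i. tau i \<in> borel_measurable M) \<and>
     (\<forall>i. V i \<in> borel_measurable M) \<and>
     (AE \<omega> in M. T0 \<omega> \<ge> 0) \<and>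
     (\<forall>i x. measure M {\<omega> \<in> space M. tau i \<omega> \<le> x} = F x) \<and>
     (\<forall>i. distr M borel (V i) = distr M borel (V 0)) \<and>
     (\<forall>i. integrable M (V i) \<and> integral\<^sup>L M (V i) = 0) \<and>
     (\<forall>i. integrable M (\<lambda>\<omega>. (norm (V i \<omega>))\<^sup>2) \<and>
          integral\<^sup>L M (\<lambda>\<omega>. (norm (V i \<omega>))\<^sup>2) = v\<^sup>2) \<and>
     prob_space.indep_vars M (\<lambda>_. borel)
        (\<lambda>j. case j of None \<Rightarrow> T0 | Some k \<Rightarrow> tau k) (UNIV :: nat option set) \<and>
     prob_space.indep_vars M (\<lambda>_. borel) V (UNIV :: nat set) \<and>
     prob_space.indep_set M
        {(\<lambda>\<omega> j. case j of None \<Rightarrow> T0 \<omega> | Some k \<Rightarrow> tau k \<omega>) -` A \<inter> space M | A.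
           A \<in> sets (PiM (UNIV :: nat option set) (\<lambda>_. borel :: real measure))}
        {(\<lambda>\<omega> i. V i \<omega>) -` B \<inter> space M | B.
           B \<in> sets (PiM (UNIV :: nat set) (\<lambda>_. borel :: 'v measure))}"

end

theory Submission
  imports Defs
begin

text \<open>
  Let \<open>L\<^sub>i\<close> be the length of the part of \<open>[0, t]\<close> on which the velocity is \<open>V\<^sub>i\<close>. Then
  \<open>X(t) = \<Sum> L\<^sub>i V\<^sub>i\<close>, and since the centred velocities are independent of each other and of the times,
  \<open>M(t) = v\<^sup>2 \<Sum> E[L\<^sub>i\<^sup>2]\<close>. Pathwise,
  \<open>min \<tau>\<^sub>k a \<cdot> 1[T\<^sub>k \<le> t - a] \<le> L\<^sub>k\<^sub>+\<^sub>1 \<le> \<tau>\<^sub>k \<cdot> 1[T\<^sub>k \<le> t]\<close>, and \<open>\<tau>\<^sub>k\<close> is independent of \<open>T\<^sub>k\<close>, so with the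
  renewal function \<open>m(t) = \<Sum> P(T\<^sub>k \<le> t)\<close>
  \<open>E[(min \<tau> a)\<^sup>2] m(t - a) \<le> M(t) / v\<^sup>2 \<le> E[(min T\<^sub>0 t)\<^sup>2] + \<sigma>\<^sup>2 m(t)\<close>.
  The elementary renewal theorem \<open>m(t) \<sim> t / E \<tau>\<close> follows in the same way by taking expectations in
  \<open>\<Sum> min \<tau>\<^sub>k b \<cdot> 1[T\<^sub>k \<le> t] \<le> t + b\<close> and \<open>t \<le> T\<^sub>0 + \<Sum> \<tau>\<^sub>k \<cdot> 1[T\<^sub>k \<le> t]\<close>.
  The delay \<open>T\<^sub>0\<close> has finite mean in both cases, hence \<open>E[(min T\<^sub>0 t)\<^sup>2] = o(t)\<close>.
\<close>

section \<open>Fundamental theorem of calculus with countably many exceptional points\<close>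

lemma fundamental_theorem_of_calculus_countable:
  fixes f :: "real \<Rightarrow> 'a::banach"
  assumes "a \<le> b" and S: "countable S" and cont: "continuous_on {a..b} f"
    and deriv: "\<And>x. x \<in> {a..b} - S \<Longrightarrow> (f has_vector_derivative f' x) (at x within {a..b})"
  shows "(f' has_integral (f b - f a)) {a..b}"
  unfolding has_integral_real
proof (intro allI impI)
  fix e :: real assume "e > 0"
  define e' where "e' = e / (b - a + 5)"
  have e': "e' > 0" using \<open>e > 0\<close> \<open>a \<le> b\<close> by (simp add: e'_def)
  \<comment> \<open>\<open>J\<close> is a bounded increasing function that jumps by at least \<open>(1/2)^k\<close> on each side of the \<open>k\<close>-th
    exceptional point. Its increments telescope over a division just like the lengths, so they
    absorb the errors at exceptional tags however often such a tag is used.\<close>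
  define s where "s = from_nat_into S"
  define h where "h y k = (1/2)^k * (of_bool (s k < y) + of_bool (s k \<le> y) :: real)" for y k
  define J where "J y = (\<Sum>k. h y k)" for y
  have geo: "summable (\<lambda>k. 2 * (1/2::real)^k)" by (intro summable_mult summable_geometric) auto
  have h0: "0 \<le> h y k" "h y k \<le> 2 * (1/2)^k" for y k
    by (auto simp: h_def)
  have sm: "summable (h y)" for y
    by (rule summable_comparison_test'[OF geo, of 0]) (use h0 in auto)
  have h_mono: "h u k \<le> h v k" if "u \<le> v" for u v k
    using that by (auto simp: h_def)
  have J_mono: "J u \<le> J v" if "u \<le> v" for u v
    unfolding J_def by (intro suminf_le sm h_mono that)
  have J0: "0 \<le> J y" for y
    unfolding J_def by (intro suminf_nonneg sm h0)
  have J4: "J y \<le> 4" for y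
  proof -
    have "J y \<le> (\<Sum>k. 2 * (1/2::real)^k)" unfolding J_def by (intro suminf_le sm geo h0)
    also have "\<dots> = 4" by (subst suminf_mult) (auto simp: suminf_geometric)
    finally show ?thesis .
  qed
  have jump: "(1/2)^k \<le> J v - J u" if "u \<le> s k" "s k \<le> v" "u < v" for u v k
  proof -
    have "(1/2)^k \<le> h v k - h u k" using that by (auto simp: h_def)
    also have "\<dots> = (\<Sum>j\<in>{k}. h v j - h u j)" by simp
    also have "\<dots> \<le> (\<Sum>j. h v j - h u j)"
      by (rule sum_le_suminf) (use that h_mono[of u v] in \<open>auto intro: summable_diff sm\<close>)
    also have "\<dots> = J v - J u" unfolding J_def by (rule suminf_diff[symmetric]; rule sm)
    finally show ?thesis .
  qed
  have "\<exists>d>0. x \<in> {a..b} \<longrightarrow> (\<forall>u v. a \<le> u \<longrightarrow> u \<le> x \<longrightarrow> x \<le> v \<longrightarrow> v \<le> b \<longrightarrow> x - u < d \<longrightarrow> v - x < d \<longrightarrow>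
         norm ((v - u) *\<^sub>R f' x - (f v - f u)) \<le> e' * (v - u) + e' * (J v - J u))" for x
  proof (cases "x \<in> {a..b}")
    case False then show ?thesis by (intro exI[of _ 1]) auto
  next
    case xab: True
    show ?thesis
    proof (cases "x \<in> S")
      case False
      then obtain d where d: "d > 0" "\<And>y. y \<in> {a..b} \<Longrightarrow> norm (y-x) < d \<Longrightarrow>
          norm (f y - f x - (y-x) *\<^sub>R f' x) \<le> e' * norm (y-x)"
        using deriv[of x, unfolded has_vector_derivative_def has_derivative_within_alt] xab e' by blast
      show ?thesis
      proof (intro exI[of _ d] conjI impI allI d)
        fix u v assume *: "a \<le> u" "u \<le> x" "x \<le> v" "v \<le> b" "x - u < d" "v - x < d"
        have "norm ((v - u) *\<^sub>R f' x - (f v - f u))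
            = norm (f u - f x - (u - x) *\<^sub>R f' x - (f v - f x - (v - x) *\<^sub>R f' x))"
          by (auto simp: algebra_simps)
        also have "\<dots> \<le> norm (f u - f x - (u - x) *\<^sub>R f' x) + norm (f v - f x - (v - x) *\<^sub>R f' x)"
          by (rule norm_triangle_ineq4)
        also have "\<dots> \<le> e' * norm (u - x) + e' * norm (v - x)"
          using * xab by (intro add_mono d) auto
        also have "\<dots> = e' * (v - u)" using * by (auto simp: algebra_simps)
        also have "\<dots> \<le> e' * (v - u) + e' * (J v - J u)" using J_mono[of u v] * e' by auto
        finally show "norm ((v - u) *\<^sub>R f' x - (f v - f u)) \<le> e' * (v - u) + e' * (J v - J u)" .
      qed
    next
      case True
      then obtain k where k: "x = s k" using from_nat_into_surj[OF S True] by (auto simp: s_def)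
      define r where "r = e' * (1/2)^k / 4"
      have r: "r > 0" using e' by (simp add: r_def)
      obtain d where d: "d > 0" "\<And>y. y \<in> {a..b} \<Longrightarrow> dist y x < d \<Longrightarrow> dist (f y) (f x) < r"
        using cont xab r unfolding continuous_on_iff by metis
      define d' where "d' = min d (r / (norm (f' x) + 1))"
      have npos: "norm (f' x) + 1 > 0" by (smt (verit) norm_ge_zero)
      have d': "d' > 0" using d r npos by (simp add: d'_def)
      have "d' * norm (f' x) \<le> d' * (norm (f' x) + 1)" using d' by simp
      also have "\<dots> \<le> r / (norm (f' x) + 1) * (norm (f' x) + 1)"
        by (rule mult_right_mono) (auto simp: d'_def)
      also have "\<dots> = r" using npos by simp
      finally have d'r: "d' * norm (f' x) \<le> r" .
      show ?thesis
      proof (intro exI[of _ d'] conjI impI allI d')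
        fix u v assume *: "a \<le> u" "u \<le> x" "x \<le> v" "v \<le> b" "x - u < d'" "v - x < d'"
        show "norm ((v - u) *\<^sub>R f' x - (f v - f u)) \<le> e' * (v - u) + e' * (J v - J u)"
        proof (cases "u = v")
          case False
          then have uv: "u < v" using * by auto
          have "norm ((v - u) *\<^sub>R f' x - (f v - f u)) \<le> norm ((v - u) *\<^sub>R f' x) + norm (f v - f u)"
            by (rule norm_triangle_ineq4)
          also have "norm ((v - u) *\<^sub>R f' x) \<le> 2 * (d' * norm (f' x))"
            using * uv mult_right_mono[of "v - u" "2*d'" "norm (f' x)"] by auto
          also have "norm (f v - f u) \<le> 2 * r"
            using d(2)[of u] d(2)[of v] * xab dist_triangle_half_l[of "f u" "f x" "2*r" "f v"]
            by (auto simp: dist_norm norm_minus_commute d'_def)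
          also have "2 * (d' * norm (f' x)) + 2 * r \<le> e' * (1/2)^k" using d'r by (simp add: r_def)
          also have "\<dots> \<le> e' * (J v - J u)" using jump[of u k v] * uv k e' by (intro mult_left_mono) auto
          also have "\<dots> \<le> e' * (v - u) + e' * (J v - J u)" using uv e' by simp
          finally show ?thesis by simp
        qed auto
      qed
    qed
  qed
  then obtain d where d: "\<And>x. d x > 0" "\<And>x u v. x \<in> {a..b} \<Longrightarrow> a \<le> u \<Longrightarrow> u \<le> x \<Longrightarrow> x \<le> v \<Longrightarrow> v \<le> b
      \<Longrightarrow> x - u < d x \<Longrightarrow> v - x < d x \<Longrightarrow>
         norm ((v - u) *\<^sub>R f' x - (f v - f u)) \<le> e' * (v - u) + e' * (J v - J u)" by metis
  show "\<exists>\<gamma>. gauge \<gamma> \<and> (\<forall>\<D>. \<D> tagged_division_of {a..b} \<and> \<gamma> fine \<D> \<longrightarrow>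
           norm ((\<Sum>(x,k)\<in>\<D>. measure lborel k *\<^sub>R f' x) - (f b - f a)) < e)"
  proof (intro exI[of _ "\<lambda>x. ball x (d x)"] conjI allI impI)
    show "gauge (\<lambda>x. ball x (d x))" using d(1) gauge_ball_dependent by blast
    fix p assume p: "p tagged_division_of {a..b} \<and> (\<lambda>x. ball x (d x)) fine p"
    then have ptag: "p tagged_division_of {a..b}" and fine: "(\<lambda>x. ball x (d x)) fine p" by auto
    note add = additive_tagged_division_1[OF \<open>a \<le> b\<close> ptag]
    have "norm (\<Sum>(x, K) \<in> p. (measure lborel K *\<^sub>R f' x) - (f (Sup K) - f (Inf K)))
          \<le> (\<Sum>(x, K)\<in>p. e' * (Sup K - Inf K) + e' * (J (Sup K) - J (Inf K)))"
    proof (rule sum_norm_le, safe)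
      fix x K assume xK: "(x, K) \<in> p"
      then obtain u v where K: "K = cbox u v" using ptag by blast
      have "x \<in> K" "K \<subseteq> {a..b}" using ptag xK by blast+
      then have *: "u \<le> x" "x \<le> v" "a \<le> u" "v \<le> b" by (auto simp: K)
      have "u \<in> ball x (d x)" "v \<in> ball x (d x)" using fine xK * K unfolding fine_def by fastforce+
      then have "x - u < d x" "v - x < d x" by (auto simp: dist_real_def)
      from d(2)[OF _ *(3,1,2,4) this] show "norm (measure lborel K *\<^sub>R f' x - (f (Sup K) - f (Inf K)))
         \<le> e' * (Sup K - Inf K) + e' * (J (Sup K) - J (Inf K))"
        using * by (simp add: K)
    qed
    also have "\<dots> = e' * (\<Sum>(x, K)\<in>p. Sup K - Inf K) + e' * (\<Sum>(x, K)\<in>p. J (Sup K) - J (Inf K))"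
      by (simp add: sum_distrib_left sum.distrib split_def)
    also have "\<dots> = e' * (b - a + (J b - J a))"
      unfolding add[of "\<lambda>x. x"] add[of J] by (simp add: distrib_left)
    also have "\<dots> < e' * (b - a + 5)"
      using J0[of a] J4[of b] e' by (intro mult_strict_left_mono) auto
    also have "\<dots> = e" using \<open>a \<le> b\<close> by (simp add: e'_def)
    finally show "norm ((\<Sum>(x,k)\<in>p. measure lborel k *\<^sub>R f' x) - (f b - f a)) < e"
      unfolding add[of f, symmetric] by (simp add: split_def sum_subtractf)
  qed
qed

section \<open>Displacement along a single path\<close>

text \<open>The switching times \<open>T\<close> are arbitrary here, neither monotone nor nonnegative nor unbounded:
  the displacement has to be measurable also on the null set of irregular paths. \<open>reached T t i\<close> is
  the running maximum of \<open>T 0, \<dots>, T (i - 1)\<close> clamped to \<open>[0, t]\<close>, so that the velocity on \<open>[0, t)\<close>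
  equals \<open>V i\<close> exactly between \<open>reached T t i\<close> and \<open>reached T t (Suc i)\<close>.\<close>
fun reached :: "(nat \<Rightarrow> real) \<Rightarrow> real \<Rightarrow> nat \<Rightarrow> real" where
  "reached T t 0 = 0"
| "reached T t (Suc i) = max (reached T t i) (min (T i) t)"

definition sojourn :: "(nat \<Rightarrow> real) \<Rightarrow> real \<Rightarrow> nat \<Rightarrow> real" where
  "sojourn T t i = reached T t (Suc i) - reached T t i"

definition step_path :: "(nat \<Rightarrow> real) \<Rightarrow> (nat \<Rightarrow> 'v::zero) \<Rightarrow> real \<Rightarrow> 'v" where
  "step_path T V s = (if \<exists>i. s < T i then V (LEAST i. s < T i) else 0)"

lemma reached_mono: "i \<le> j \<Longrightarrow> reached T t i \<le> reached T t j"
  by (rule lift_Suc_mono_le) auto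

lemma reached_nonneg: "0 \<le> reached T t i"
  by (induction i) (auto simp: le_max_iff_disj)

lemma reached_le: "0 \<le> t \<Longrightarrow> reached T t i \<le> t"
  by (induction i) auto

lemma sojourn_nonneg: "0 \<le> sojourn T t i"
  by (simp add: sojourn_def)

lemma sojourn_le: "0 \<le> t \<Longrightarrow> sojourn T t i \<le> t"
  using reached_le[of t T "Suc i"] reached_nonneg[of T t i] by (simp add: sojourn_def)

lemma sum_sojourn: "(\<Sum>i<n. sojourn T t i) = reached T t n"
  unfolding sojourn_def by (subst sum_lessThan_telescope) simp

lemma min_le_reached: "j < i \<Longrightarrow> min (T j) t \<le> reached T t i"
proof -
  assume "j < i"
  then have "reached T t (Suc j) \<le> reached T t i" by (intro reached_mono) auto
  then show ?thesis by simp
qed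

lemma step_path_eq:
  assumes "0 \<le> t" "reached T t i \<le> s" "s < reached T t (Suc i)"
  shows "step_path T V s = V i"
proof -
  have st: "s < t" using assms reached_le[of t T "Suc i"] by linarith
  have "T j \<le> s" if "j < i" for j using min_le_reached[OF that, of T t] assms st by (auto simp: min_def split: if_splits)
  moreover have "s < T i" using assms by auto
  ultimately have "(LEAST i. s < T i) = i" by (intro Least_equality) (auto simp: not_less[symmetric])
  then show ?thesis using \<open>s < T i\<close> by (auto simp: step_path_def)
qed

lemma step_path_eq_0:
  assumes "\<And>n. reached T t n \<le> s" "s < t"
  shows "step_path T V s = 0"
proof -
  have "T j \<le> s" for j
    using min_le_reached[of j "Suc j" T t] assms(1)[of "Suc j"] assms(2) by (auto simp: min_def split: if_splits)
  then show ?thesis by (auto simp: step_path_def not_less[symmetric])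
qed

lemma reached_limit:
  assumes "0 \<le> t"
  obtains L where "reached T t \<longlonglongrightarrow> L" "\<And>n. reached T t n \<le> L" "0 \<le> L" "L \<le> t"
proof -
  have inc: "incseq (reached T t)" by (auto simp: incseq_def reached_mono)
  then obtain L where L: "reached T t \<longlonglongrightarrow> L" "\<forall>n. reached T t n \<le> L"
    using incseq_convergent[of "reached T t" t] reached_le[OF assms] by metis
  then show thesis using that[of L] LIMSEQ_le_const2[OF L(1), of t] reached_le[OF assms] spec[OF L(2), of 0] by auto
qed

lemma has_integral_step_path:
  fixes V :: "nat \<Rightarrow> 'v::euclidean_space"
  assumes "0 \<le> t"
  shows "(step_path T V has_integral (\<Sum>i<n. sojourn T t i *\<^sub>R V i)) {0..reached T t n}"
proof (induction n)
  case (Suc n)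
  have "(step_path T V has_integral (sojourn T t n *\<^sub>R V n)) {reached T t n..reached T t (Suc n)}"
  proof (rule has_integral_spike_finite[where S="{reached T t (Suc n)}"])
    show "((\<lambda>_. V n) has_integral sojourn T t n *\<^sub>R V n) {reached T t n..reached T t (Suc n)}"
      using has_integral_const_real[of "V n" "reached T t n" "reached T t (Suc n)"]
      by (simp add: sojourn_def reached_mono del: reached.simps(2))
    fix s assume "s \<in> {reached T t n..reached T t (Suc n)} - {reached T t (Suc n)}"
    then show "step_path T V s = V n" using assms by (intro step_path_eq[of t]) auto
  qed auto
  from has_integral_combine[OF reached_nonneg _ Suc this] show ?case
    by (simp add: reached_mono)
qed auto

lemma integrable_step_path:
  fixes V :: "nat \<Rightarrow> 'v::euclidean_space"
  assumes t: "0 \<le> t" and conv: "convergent (\<lambda>n. \<Sum>i<n. sojourn T t i *\<^sub>R V i)"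
  shows "step_path T V integrable_on {0..t}"
proof -
  let ?B = "reached T t"
  \<comment> \<open>The primitive is the piecewise linear interpolation of the partial sums.\<close>
  define P where "P n = (\<Sum>i<n. sojourn T t i *\<^sub>R V i)" for n
  define \<Phi> where "\<Phi> n s = (\<Sum>i<n. (min s (?B (Suc i)) - min s (?B i)) *\<^sub>R V i)" for n s
  have stable: "\<Phi> m s = \<Phi> n s" if "s \<le> ?B n" "n \<le> m" for m n s
    using that(2)
  proof (induction m rule: dec_induct)
    case (step m)
    have "s \<le> ?B m" "s \<le> ?B (Suc m)" using that(1) reached_mono[of n m T t] reached_mono[of n "Suc m" T t] step by linarith+
    then show ?case using step by (simp add: \<Phi>_def del: reached.simps)
  qed auto
  have past: "\<Phi> n s = P n" if "?B n \<le> s" for n s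
    unfolding \<Phi>_def P_def sojourn_def
  proof (intro sum.cong refl)
    fix i assume "i \<in> {..<n}"
    then have "?B i \<le> s" "?B (Suc i) \<le> s"
      using that reached_mono[of i n T t] reached_mono[of "Suc i" n T t] by (auto simp del: reached.simps)
    then show "(min s (?B (Suc i)) - min s (?B i)) *\<^sub>R V i = (?B (Suc i) - ?B i) *\<^sub>R V i" by (simp add: min_def del: reached.simps)
  qed
  have inter: "\<Phi> (Suc n) s = P n + (s - ?B n) *\<^sub>R V n" if "?B n \<le> s" "s \<le> ?B (Suc n)" for n s
  proof -
    have "\<Phi> (Suc n) s = \<Phi> n s + (min s (?B (Suc n)) - min s (?B n)) *\<^sub>R V n"
      by (simp add: \<Phi>_def del: reached.simps)
    then show ?thesis using that past[of n s] by (simp add: min_def del: reached.simps)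
  qed
  have in_ball: "\<Phi> m s \<in> cball (P n) e" if "?B n \<le> s" "n \<le> m" and P: "\<And>j. n \<le> j \<Longrightarrow> P j \<in> cball (P n) e" for m n s e
    using that(2)
  proof (induction m rule: dec_induct)
    case base then show ?case using past[OF that(1)] P[of n] by simp
  next
    case (step m)
    consider "s \<le> ?B m" | "?B m \<le> s" "s \<le> ?B (Suc m)" | "?B (Suc m) \<le> s" by linarith
    then show ?case
    proof cases
      case 1 then show ?thesis using stable[of s m "Suc m"] step by simp
    next
      case 2
      show ?thesis
      proof (cases "?B m = ?B (Suc m)")
        case True then show ?thesis using inter[OF 2] P[of m] step 2 by simp
      next
        case False
        then have pos: "sojourn T t m > 0" using sojourn_nonneg[of T t m] by (auto simp: sojourn_def simp del: reached.simps)
        define \<theta> where "\<theta> = (s - ?B m) / sojourn T t m"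
        have th: "0 \<le> \<theta>" "\<theta> \<le> 1" using 2 pos by (auto simp: \<theta>_def sojourn_def divide_le_eq simp del: reached.simps)
        have "\<Phi> (Suc m) s = P m + (\<theta> * sojourn T t m) *\<^sub>R V m" using inter[OF 2] pos by (simp add: \<theta>_def)
        also have "\<dots> = (1 - \<theta>) *\<^sub>R P m + \<theta> *\<^sub>R P (Suc m)" by (simp add: P_def algebra_simps)
        also have "\<dots> \<in> cball (P n) e"
          using convexD[OF convex_cball P[of m] P[of "Suc m"], of "1 - \<theta>" \<theta>] th step by auto
        finally show ?thesis .
      qed
    next
      case 3 then show ?thesis using past P[of "Suc m"] step by simp
    qed
  qed
  have "Cauchy P" using conv unfolding P_def by (rule convergent_Cauchy)
  have "uniformly_Cauchy_on UNIV \<Phi>"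
    unfolding uniformly_Cauchy_on_def
  proof (intro allI impI)
    fix e :: real assume "e > 0"
    then obtain N where N: "\<And>m n. m \<ge> N \<Longrightarrow> n \<ge> N \<Longrightarrow> dist (P m) (P n) < e/2"
      using \<open>Cauchy P\<close> unfolding Cauchy_def by (meson half_gt_zero)
    have "dist (\<Phi> m s) (\<Phi> n s) < e" if "N \<le> n" "n \<le> m" for m n s
    proof (cases "s \<le> ?B n")
      case True then show ?thesis using stable[OF True that(2)] \<open>e > 0\<close> by simp
    next
      case False
      then have "\<Phi> m s \<in> cball (P n) (e/2)" using that N[of n] by (intro in_ball) (auto simp: less_imp_le)
      then show ?thesis using past[of n s] False \<open>e > 0\<close> by (auto simp: dist_commute)
    qed
    then show "\<exists>M. \<forall>x\<in>UNIV. \<forall>m\<ge>M. \<forall>n\<ge>M. dist (\<Phi> m x) (\<Phi> n x) < e"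
      by (metis dist_commute le_cases)
  qed
  then obtain \<Psi> where \<Psi>: "uniform_limit UNIV \<Phi> \<Psi> sequentially"
    using Cauchy_uniformly_convergent uniformly_convergent_on_def by blast
  have \<Psi>lim: "(\<lambda>n. \<Phi> n s) \<longlonglongrightarrow> \<Psi> s" for s
    using \<Psi> by (rule tendsto_uniform_limitI) auto
  have cont: "continuous_on UNIV \<Psi>"
    by (rule uniform_limit_theorem[OF _ \<Psi>]) (auto simp: \<Phi>_def intro!: always_eventually continuous_intros)
  obtain L where L: "?B \<longlonglongrightarrow> L" and BL: "\<And>n. ?B n \<le> L" and Lt: "0 \<le> L" "L \<le> t"
    using reached_limit[OF t] by blast
  obtain p where p: "P \<longlonglongrightarrow> p" using conv unfolding P_def convergent_def by blast
  have "(step_path T V has_integral (\<Psi> t - \<Psi> 0)) {0..t}"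
  proof (rule fundamental_theorem_of_calculus_countable[where S="range ?B \<union> {L, t}"])
    show "continuous_on {0..t} \<Psi>" using cont continuous_on_subset by blast
    fix x assume x: "x \<in> {0..t} - (range ?B \<union> {L, t})"
    show "(\<Psi> has_vector_derivative step_path T V x) (at x within {0..t})"
    proof (rule has_vector_derivative_at_within, cases "x < L")
      case True
      then have ex: "\<exists>n. x < ?B n" using order_tendstoD(1)[OF L True] by (auto simp: eventually_sequentially)
      define k where "k = (LEAST n. x < ?B n)"
      have k: "x < ?B k" unfolding k_def using ex by (rule LeastI_ex)
      then obtain i where i: "k = Suc i" using x by (cases k) auto
      have "\<not> x < ?B i" using not_less_Least[of i "\<lambda>n. x < ?B n"] i k_def by auto
      then have xi: "?B i < x" using x by (metis DiffE UnI1 linorder_cases rangeI)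
      have form: "\<Psi> y = P i + (y - ?B i) *\<^sub>R V i" if "y \<in> {?B i<..<?B (Suc i)}" for y
      proof -
        have "eventually (\<lambda>n. \<Phi> n y = P i + (y - ?B i) *\<^sub>R V i) sequentially"
          using eventually_ge_at_top[of "Suc i"]
        proof eventually_elim
          case (elim n)
          have "y \<le> ?B (Suc i)" "?B i \<le> y" using that by (simp_all del: reached.simps)
          then show ?case by (simp only: stable[OF _ elim] inter)
        qed
        then show ?thesis using LIMSEQ_unique[OF \<Psi>lim tendsto_eventually] by simp
      qed
      have "((\<lambda>y. P i + (y - ?B i) *\<^sub>R V i) has_vector_derivative V i) (at x)"
        by (auto intro!: derivative_eq_intros)
      then have "(\<Psi> has_vector_derivative V i) (at x)"
        by (rule has_vector_derivative_transform_within_open[of _ _ _ "{?B i<..<?B (Suc i)}"])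
           (use xi k i form in \<open>auto simp del: reached.simps\<close>)
      then show "(\<Psi> has_vector_derivative step_path T V x) (at x)"
        using step_path_eq[OF t, of T i x V] xi k i by (simp del: reached.simps)
    next
      case False
      then have xL: "L < x" "x < t" using x by auto
      have form: "\<Psi> y = p" if "y \<in> {L<..}" for y
      proof -
        have "\<Phi> n y = P n" for n using past[of n y] BL[of n] that by auto
        then show ?thesis using \<Psi>lim[of y] p LIMSEQ_unique by auto
      qed
      have "((\<lambda>y. p) has_vector_derivative 0) (at x)" by auto
      then have "(\<Psi> has_vector_derivative 0) (at x)"
        by (rule has_vector_derivative_transform_within_open[of _ _ _ "{L<..}"])
           (use xL form in auto)
      moreover have "step_path T V x = 0"
        by (rule step_path_eq_0[of T t]) (use xL BL order_trans less_imp_le in blast)+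
      ultimately show "(\<Psi> has_vector_derivative step_path T V x) (at x)" by simp
    qed
  qed (use t in auto)
  then show ?thesis by blast
qed

text \<open>If infinitely many switches accumulate before \<open>t\<close>, the integral is a genuinely improper
  Henstock--Kurzweil integral, and it is \<open>0\<close> by convention when the sums diverge.\<close>
lemma integral_step_path:
  fixes T :: "nat \<Rightarrow> real" and V :: "nat \<Rightarrow> 'v::euclidean_space"
  assumes t: "0 \<le> t"
  defines "P \<equiv> \<lambda>n. \<Sum>i<n. sojourn T t i *\<^sub>R V i"
  shows "integral {0..t} (step_path T V) = (if convergent P then lim P else 0)"
proof -
  let ?B = "reached T t"
  have "P \<longlonglongrightarrow> integral {0..t} (step_path T V)" if int: "step_path T V integrable_on {0..t}"
  proof -
    obtain L where L: "?B \<longlonglongrightarrow> L" and BL: "\<And>n. ?B n \<le> L" and Lt: "0 \<le> L" "L \<le> t"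
      using reached_limit[OF t] by blast
    have "continuous_on {0..t} (\<lambda>s. integral {0..s} (step_path T V))"
      using int by (rule indefinite_integral_continuous_1)
    then have "(\<lambda>n. integral {0..?B n} (step_path T V)) \<longlonglongrightarrow> integral {0..L} (step_path T V)"
      by (rule continuous_on_tendsto_compose[OF _ L])
         (use Lt reached_nonneg reached_le[OF t] in \<open>auto intro!: always_eventually\<close>)
    moreover have "integral {0..?B n} (step_path T V) = P n" for n
      using has_integral_step_path[OF t] unfolding P_def by (rule integral_unique)
    moreover have "integral {0..t} (step_path T V) = integral {0..L} (step_path T V)"
    proof -
      have "(step_path T V has_integral 0) {L..t}"
      proof (rule has_integral_spike_finite[where S="{t}"])
        show "((\<lambda>_. 0) has_integral 0) {L..t}" by simp
        fix x assume "x \<in> {L..t} - {t}"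
        then show "step_path T V x = 0" using BL order_trans by (intro step_path_eq_0[of T t]) auto
      qed auto
      then have "integral {L..t} (step_path T V) = 0" by (rule integral_unique)
      then show ?thesis using Henstock_Kurzweil_Integration.integral_combine[OF Lt int] by simp
    qed
    ultimately show ?thesis by simp
  qed
  note lim = this
  show ?thesis
  proof (cases "convergent P")
    case True
    then have "P \<longlonglongrightarrow> integral {0..t} (step_path T V)"
      using lim integrable_step_path[OF t] unfolding P_def by blast
    then show ?thesis using True by (simp add: limI)
  next
    case False
    then have "\<not> step_path T V integrable_on {0..t}" using lim convergentI by blast
    then show ?thesis using False by (simp add: not_integrable_integral)
  qed
qed

section \<open>Moments as tail integrals\<close>

lemma (in prob_space) nn_integral_tail:
  fixes X :: "'a \<Rightarrow> real" and h H :: "real \<Rightarrow> real"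
  assumes X[measurable]: "X \<in> borel_measurable M" and nonneg: "AE \<omega> in M. 0 \<le> X \<omega>"
    and h[measurable]: "h \<in> borel_measurable borel" and h0: "\<And>s. 0 \<le> s \<Longrightarrow> 0 \<le> h s"
    and H: "\<And>s. 0 \<le> s \<Longrightarrow> (H has_real_derivative h s) (at s)" and H0: "H 0 = 0"
  shows "(\<integral>\<^sup>+\<omega>. ennreal (H (X \<omega>)) \<partial>M) =
    (\<integral>\<^sup>+s. ennreal (indicator {0..} s * (h s * (1 - prob {\<omega> \<in> space M. X \<omega> \<le> s}))) \<partial>lborel)"
proof -
  interpret pair_sigma_finite M lborel ..
  let ?f = "\<lambda>\<omega> s. if 0 \<le> s \<and> s < X \<omega> then ennreal (h s) else 0"
  have "(\<integral>\<^sup>+\<omega>. ennreal (H (X \<omega>)) \<partial>M) = (\<integral>\<^sup>+\<omega>. (\<integral>\<^sup>+s. ?f \<omega> s \<partial>lborel) \<partial>M)"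
  proof (rule nn_integral_cong_AE, use nonneg in eventually_elim)
    case (elim \<omega>)
    have "(\<integral>\<^sup>+s. ennreal (h s) * indicator {0..X \<omega>} s \<partial>lborel) = ennreal (H (X \<omega>) - H 0)"
      by (rule nn_integral_FTC_Icc) (use elim h0 H in auto)
    moreover have "(\<integral>\<^sup>+s. ennreal (h s) * indicator {0..X \<omega>} s \<partial>lborel) = (\<integral>\<^sup>+s. ?f \<omega> s \<partial>lborel)"
    proof (rule nn_integral_cong_AE)
      show "AE s in lborel. ennreal (h s) * indicator {0..X \<omega>} s = ?f \<omega> s"
        using AE_lborel_singleton[of "X \<omega>"] by eventually_elim (auto simp: indicator_def)
    qed
    ultimately show ?case by (simp add: H0)
  qed
  also have "\<dots> = (\<integral>\<^sup>+s. (\<integral>\<^sup>+\<omega>. ?f \<omega> s \<partial>M) \<partial>lborel)"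
    by (rule Fubini'[symmetric]) measurable
  also have "\<dots> = (\<integral>\<^sup>+s. ennreal (indicator {0..} s * (h s * (1 - prob {\<omega> \<in> space M. X \<omega> \<le> s}))) \<partial>lborel)"
  proof (rule nn_integral_cong)
    fix s
    have "(\<integral>\<^sup>+\<omega>. ?f \<omega> s \<partial>M) = (\<integral>\<^sup>+\<omega>. ennreal (indicator {0..} s * h s) * indicator {\<omega> \<in> space M. s < X \<omega>} \<omega> \<partial>M)"
      by (rule nn_integral_cong) (auto simp: indicator_def)
    also have "\<dots> = ennreal (indicator {0..} s * h s) * emeasure M {\<omega> \<in> space M. s < X \<omega>}"
      by (rule nn_integral_cmult_indicator) measurable
    also have "emeasure M {\<omega> \<in> space M. s < X \<omega>} = ennreal (1 - prob {\<omega> \<in> space M. X \<omega> \<le> s})"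
      using prob_neg[of "\<lambda>\<omega>. X \<omega> \<le> s"] by (simp add: emeasure_eq_measure not_le)
    also have "ennreal (indicator {0..} s * h s) * \<dots> = ennreal (indicator {0..} s * (h s * (1 - prob {\<omega> \<in> space M. X \<omega> \<le> s})))"
      by (subst ennreal_mult'[symmetric]) (auto simp: indicator_def h0)
    finally show "(\<integral>\<^sup>+\<omega>. ?f \<omega> s \<partial>M) = ennreal (indicator {0..} s * (h s * (1 - prob {\<omega> \<in> space M. X \<omega> \<le> s})))" .
  qed
  finally show ?thesis .
qed

lemma (in prob_space) expectation_tail:
  fixes X :: "'a \<Rightarrow> real" and h H :: "real \<Rightarrow> real"
  assumes X[measurable]: "X \<in> borel_measurable M" and nonneg: "AE \<omega> in M. 0 \<le> X \<omega>"
    and h[measurable]: "h \<in> borel_measurable borel" and h0: "\<And>s. 0 \<le> s \<Longrightarrow> 0 \<le> h s"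
    and H: "\<And>s. 0 \<le> s \<Longrightarrow> (H has_real_derivative h s) (at s)" and H0: "H 0 = 0"
    and Hm: "H \<in> borel_measurable borel" and Hn: "\<And>x. 0 \<le> x \<Longrightarrow> 0 \<le> H x"
    and int: "set_integrable lborel {0..} (\<lambda>s. h s * (1 - prob {\<omega> \<in> space M. X \<omega> \<le> s}))"
  shows "has_bochner_integral M (\<lambda>\<omega>. H (X \<omega>)) (LBINT s:{0..}. h s * (1 - prob {\<omega> \<in> space M. X \<omega> \<le> s}))"
proof (rule has_bochner_integral_nn_integral)
  show "(\<lambda>\<omega>. H (X \<omega>)) \<in> borel_measurable M" using Hm by measurable
  show "AE \<omega> in M. 0 \<le> H (X \<omega>)" using nonneg by eventually_elim (rule Hn)
  have nn: "0 \<le> indicator {0..} s * (h s * (1 - prob {\<omega> \<in> space M. X \<omega> \<le> s}))" for s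
    by (auto simp: indicator_def h0)
  show "0 \<le> (LBINT s:{0..}. h s * (1 - prob {\<omega> \<in> space M. X \<omega> \<le> s}))"
    unfolding set_lebesgue_integral_def using nn by (auto intro!: integral_nonneg)
  show "(\<integral>\<^sup>+\<omega>. ennreal (H (X \<omega>)) \<partial>M) = ennreal (LBINT s:{0..}. h s * (1 - prob {\<omega> \<in> space M. X \<omega> \<le> s}))"
    unfolding set_lebesgue_integral_def real_scaleR_def
    by (subst nn_integral_tail[OF X nonneg h h0 H H0], (assumption | rule refl)+, rule nn_integral_eq_integral) (use int nn in \<open>auto simp: set_integrable_def\<close>)
qed

section \<open>Elementary renewal theorem\<close>

locale renewal_process =
  fixes M :: "'a measure" and F :: "real \<Rightarrow> real" and T0 :: "'a \<Rightarrow> real"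
    and tau :: "nat \<Rightarrow> 'a \<Rightarrow> real" and V :: "nat \<Rightarrow> 'a \<Rightarrow> 'v::euclidean_space" and v :: real
  assumes model: "renewal_model M F T0 tau V v"
    and F_0: "F 0 = 0"
    and mean_fin: "set_integrable lborel {0..} (\<lambda>s. 1 - F s)"
    and second_fin: "set_integrable lborel {0..} (\<lambda>s. 2 * s * (1 - F s))"

sublocale renewal_process \<subseteq> prob_space M
  using model by (simp add: renewal_model_def)

context renewal_process
begin

abbreviation T :: "nat \<Rightarrow> 'a \<Rightarrow> real" where "T \<equiv> renewal_times T0 tau"

definition mean :: real where "mean = (LBINT s:{0..}. 1 - F s)"
definition second_moment :: real where "second_moment = (LBINT s:{0..}. 2 * s * (1 - F s))"

lemma measurable_T0 [measurable]: "T0 \<in> borel_measurable M"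
  and measurable_tau [measurable]: "tau k \<in> borel_measurable M"
  and measurable_V [measurable]: "V k \<in> borel_measurable M"
  using model by (auto simp: renewal_model_def)

lemma measurable_T [measurable]: "T k \<in> borel_measurable M"
  unfolding renewal_times_def by measurable

lemma prob_tau_le: "prob {\<omega> \<in> space M. tau k \<omega> \<le> x} = F x"
  using model by (simp add: renewal_model_def)

lemma AE_T0_nonneg: "AE \<omega> in M. 0 \<le> T0 \<omega>"
  using model by (simp add: renewal_model_def)

lemma AE_tau_pos: "AE \<omega> in M. \<forall>k. 0 < tau k \<omega>"
proof (subst AE_all_countable, rule allI)
  fix k
  have "AE \<omega> in M. \<not> tau k \<omega> \<le> 0"
    using prob_tau_le[of k 0] F_0 prob_Collect_eq_0[of "\<lambda>\<omega>. tau k \<omega> \<le> 0"] by simp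
  then show "AE \<omega> in M. 0 < tau k \<omega>" by (simp add: not_le)
qed

lemma mean_tau: "has_bochner_integral M (tau k) mean"
proof -
  have "has_bochner_integral M (\<lambda>\<omega>. tau k \<omega>) (LBINT s:{0..}. 1 * (1 - prob {\<omega> \<in> space M. tau k \<omega> \<le> s}))"
  proof (rule expectation_tail)
    show "AE \<omega> in M. 0 \<le> tau k \<omega>" using AE_tau_pos by eventually_elim (auto simp: less_imp_le)
  qed (use mean_fin in \<open>auto simp: prob_tau_le\<close>)
  then show ?thesis by (simp add: prob_tau_le mean_def)
qed

lemma second_moment_tau: "has_bochner_integral M (\<lambda>\<omega>. (tau k \<omega>)\<^sup>2) second_moment"
proof -
  have "has_bochner_integral M (\<lambda>\<omega>. (tau k \<omega>)\<^sup>2) (LBINT s:{0..}. 2 * s * (1 - prob {\<omega> \<in> space M. tau k \<omega> \<le> s}))"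
  proof (rule expectation_tail)
    show "AE \<omega> in M. 0 \<le> tau k \<omega>" using AE_tau_pos by eventually_elim (auto simp: less_imp_le)
    show "((\<lambda>x. x\<^sup>2) has_real_derivative 2 * s) (at s)" for s :: real
      by (auto intro!: derivative_eq_intros)
  qed (use second_fin in \<open>auto simp: prob_tau_le\<close>)
  then show ?thesis by (simp add: prob_tau_le second_moment_def)
qed

lemma integrable_tau: "integrable M (tau k)" and expectation_tau: "expectation (tau k) = mean"
  using mean_tau by (auto simp: has_bochner_integral_iff)

lemma integrable_tau_sq: "integrable M (\<lambda>\<omega>. (tau k \<omega>)\<^sup>2)"
  and expectation_tau_sq: "expectation (\<lambda>\<omega>. (tau k \<omega>)\<^sup>2) = second_moment"
  using second_moment_tau by (auto simp: has_bochner_integral_iff)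

lemma expectation_pos:
  fixes f :: "'a \<Rightarrow> real"
  assumes "integrable M f" "AE \<omega> in M. 0 < f \<omega>"
  shows "0 < expectation f"
proof -
  have nn: "AE \<omega> in M. 0 \<le> f \<omega>" using assms(2) by eventually_elim simp
  have "expectation f \<noteq> 0"
  proof
    assume "expectation f = 0"
    then have "AE \<omega> in M. f \<omega> = 0" using integral_nonneg_eq_0_iff_AE[OF assms(1) nn] by simp
    with assms(2) have "AE \<omega> in M. False" by eventually_elim simp
    then show False by simp
  qed
  then show ?thesis using integral_nonneg_AE[OF nn] by linarith
qed

lemma mean_pos: "0 < mean"
proof -
  have "AE \<omega> in M. 0 < tau 0 \<omega>" using AE_tau_pos by eventually_elim blast
  from expectation_pos[OF integrable_tau this] show ?thesis by (simp add: expectation_tau)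
qed

lemma second_moment_pos: "0 < second_moment"
proof -
  have "AE \<omega> in M. 0 < (tau 0 \<omega>)\<^sup>2" using AE_tau_pos by eventually_elim (rule zero_less_power, blast)
  from expectation_pos[OF integrable_tau_sq this] show ?thesis by (simp add: expectation_tau_sq)
qed

lemma distr_tau: "distr M borel (tau k) = distr M borel (tau 0)"
proof (rule cdf_unique)
  have "measure (distr M borel (tau k)) {..x} = F x" for k x
    using prob_tau_le[of k x] by (subst measure_distr) (auto simp: vimage_def Int_def conj_commute)
  then show "cdf (distr M borel (tau k)) = cdf (distr M borel (tau 0))"
    by (simp add: cdf_def fun_eq_iff)
qed (auto intro: real_distribution_distr)

lemma expectation_tau_eq:
  fixes h :: "real \<Rightarrow> real"
  assumes [measurable]: "h \<in> borel_measurable borel"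
  shows "expectation (\<lambda>\<omega>. h (tau k \<omega>)) = expectation (\<lambda>\<omega>. h (tau 0 \<omega>))"
  using integral_distr[of "tau k" M borel h] integral_distr[of "tau 0" M borel h] distr_tau[of k] by simp

lemma indep_tau_T: "indep_var borel (tau k) borel (T k)"
proof -
  let ?X = "\<lambda>j. case j of None \<Rightarrow> T0 | Some k \<Rightarrow> tau k"
  have "indep_vars (\<lambda>_. borel) ?X UNIV" using model by (simp add: renewal_model_def)
  then have "indep_vars (\<lambda>_. borel) ?X (insert (Some k) (insert None (Some ` {..<k})))"
    by (rule indep_vars_subset) auto
  then have "indep_var borel (?X (Some k)) borel (\<lambda>\<omega>. \<Sum>j\<in>insert None (Some ` {..<k}). ?X j \<omega>)"
    by (intro indep_vars_sum) auto
  moreover have "(\<lambda>\<omega>. \<Sum>j\<in>insert None (Some ` {..<k}). ?X j \<omega>) = T k"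
    by (auto simp: renewal_times_def sum.reindex fun_eq_iff)
  ultimately show ?thesis by simp
qed

lemma expectation_tau_indicator:
  fixes h :: "real \<Rightarrow> real"
  assumes [measurable]: "h \<in> borel_measurable borel" and int: "integrable M (\<lambda>\<omega>. h (tau k \<omega>))"
  shows "integrable M (\<lambda>\<omega>. h (tau k \<omega>) * indicator {..t} (T k \<omega>))"
    and "expectation (\<lambda>\<omega>. h (tau k \<omega>) * indicator {..t} (T k \<omega>)) =
         expectation (\<lambda>\<omega>. h (tau 0 \<omega>)) * prob {\<omega> \<in> space M. T k \<omega> \<le> t}"
proof -
  have ind: "indep_var borel (\<lambda>\<omega>. h (tau k \<omega>)) borel (\<lambda>\<omega>. indicator {..t} (T k \<omega>) :: real)"
    using indep_var_compose[OF indep_tau_T, of h borel "indicator {..t}" borel] by (simp add: comp_def)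
  have int2: "integrable M (\<lambda>\<omega>. indicator {..t} (T k \<omega>) :: real)"
    by (rule integrable_const_bound[of _ 1]) auto
  show "integrable M (\<lambda>\<omega>. h (tau k \<omega>) * indicator {..t} (T k \<omega>))"
    by (rule indep_var_integrable[OF ind int int2])
  have "expectation (\<lambda>\<omega>. indicator {..t} (T k \<omega>) :: real) = expectation (indicator {\<omega> \<in> space M. T k \<omega> \<le> t})"
    by (rule Bochner_Integration.integral_cong) (auto simp: indicator_def)
  then have "expectation (\<lambda>\<omega>. indicator {..t} (T k \<omega>) :: real) = prob {\<omega> \<in> space M. T k \<omega> \<le> t}"
    by simp
  then show "expectation (\<lambda>\<omega>. h (tau k \<omega>) * indicator {..t} (T k \<omega>)) =
         expectation (\<lambda>\<omega>. h (tau 0 \<omega>)) * prob {\<omega> \<in> space M. T k \<omega> \<le> t}"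
    by (simp only: indep_var_lebesgue_integral[OF ind int int2] expectation_tau_eq[OF assms(1), of k])
qed

definition truncated_mean :: "real \<Rightarrow> real" where
  "truncated_mean b = expectation (\<lambda>\<omega>. min (tau 0 \<omega>) b)"

definition truncated_second_moment :: "real \<Rightarrow> real" where
  "truncated_second_moment a = expectation (\<lambda>\<omega>. (min (tau 0 \<omega>) a)\<^sup>2)"

lemma T_0 [simp]: "T 0 \<omega> = T0 \<omega>"
  and T_Suc: "T (Suc k) \<omega> = T k \<omega> + tau k \<omega>"
  by (simp_all add: renewal_times_def)

lemma AE_regular: "AE \<omega> in M. 0 \<le> T0 \<omega> \<and> (\<forall>k. 0 < tau k \<omega>)"
  using AE_T0_nonneg AE_tau_pos by eventually_elim simp

lemma T_nonneg:
  assumes "0 \<le> T0 \<omega> \<and> (\<forall>k. 0 < tau k \<omega>)"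
  shows "0 \<le> T n \<omega>"
  using assms by (simp add: renewal_times_def sum_nonneg less_imp_le)

lemma integrable_min_tau: "0 \<le> b \<Longrightarrow> integrable M (\<lambda>\<omega>. min (tau k \<omega>) b)"
proof (rule integrable_const_bound[of _ b])
  assume "0 \<le> b"
  show "AE \<omega> in M. norm (min (tau k \<omega>) b) \<le> b"
    using AE_tau_pos by eventually_elim (use \<open>0 \<le> b\<close> in \<open>auto simp: min_def less_imp_le\<close>)
qed measurable

lemma integrable_min_tau_sq: "0 \<le> a \<Longrightarrow> integrable M (\<lambda>\<omega>. (min (tau k \<omega>) a)\<^sup>2)"
proof (rule integrable_const_bound[of _ "a\<^sup>2"])
  assume "0 \<le> a"
  show "AE \<omega> in M. norm ((min (tau k \<omega>) a)\<^sup>2) \<le> a\<^sup>2"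
    using AE_tau_pos
  proof eventually_elim
    case (elim \<omega>)
    then have "0 \<le> min (tau k \<omega>) a" using \<open>0 \<le> a\<close> by (auto simp: less_imp_le)
    then show ?case by (auto intro: power_mono)
  qed
qed measurable

lemma truncated_mean_pos: "0 < b \<Longrightarrow> 0 < truncated_mean b"
  unfolding truncated_mean_def
proof (rule expectation_pos)
  assume "0 < b"
  show "AE \<omega> in M. 0 < min (tau 0 \<omega>) b"
    using AE_tau_pos by eventually_elim (use \<open>0 < b\<close> in auto)
qed (simp add: integrable_min_tau)

lemma truncated_second_moment_nonneg: "0 \<le> truncated_second_moment a"
  unfolding truncated_second_moment_def by simp

lemma truncated_mean_tendsto: "(\<lambda>n. truncated_mean (real n)) \<longlonglongrightarrow> mean"
  unfolding truncated_mean_def expectation_tau[of 0, symmetric]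
proof (rule integral_dominated_convergence[where w="tau 0"])
  show "AE \<omega> in M. (\<lambda>n. min (tau 0 \<omega>) (real n)) \<longlonglongrightarrow> tau 0 \<omega>"
  proof (intro AE_I2 tendsto_eventually)
    fix \<omega>
    show "\<forall>\<^sub>F n in sequentially. min (tau 0 \<omega>) (real n) = tau 0 \<omega>"
      using eventually_ge_at_top[of "nat \<lceil>tau 0 \<omega>\<rceil>"] by eventually_elim (auto simp: min_def nat_le_iff ceiling_le_iff)
  qed
  show "AE \<omega> in M. norm (min (tau 0 \<omega>) (real n)) \<le> tau 0 \<omega>" for n
    using AE_tau_pos by eventually_elim (auto simp: min_def less_imp_le)
qed (auto intro: integrable_tau)

lemma truncated_second_moment_tendsto: "(\<lambda>n. truncated_second_moment (real n)) \<longlonglongrightarrow> second_moment"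
  unfolding truncated_second_moment_def expectation_tau_sq[of 0, symmetric]
proof (rule integral_dominated_convergence[where w="\<lambda>\<omega>. (tau 0 \<omega>)\<^sup>2"])
  show "AE \<omega> in M. (\<lambda>n. (min (tau 0 \<omega>) (real n))\<^sup>2) \<longlonglongrightarrow> (tau 0 \<omega>)\<^sup>2"
  proof (intro AE_I2 tendsto_eventually)
    fix \<omega>
    show "\<forall>\<^sub>F n in sequentially. (min (tau 0 \<omega>) (real n))\<^sup>2 = (tau 0 \<omega>)\<^sup>2"
      using eventually_ge_at_top[of "nat \<lceil>tau 0 \<omega>\<rceil>"] by eventually_elim (auto simp: min_def nat_le_iff ceiling_le_iff)
  qed
  show "AE \<omega> in M. norm ((min (tau 0 \<omega>) (real n))\<^sup>2) \<le> (tau 0 \<omega>)\<^sup>2" for n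
    using AE_tau_pos
  proof eventually_elim
    case (elim \<omega>)
    then have "0 \<le> min (tau 0 \<omega>) (real n)" by (auto simp: less_imp_le)
    then show ?case by (auto intro: power_mono)
  qed
qed (auto intro: integrable_tau_sq)

definition renewal_prob :: "nat \<Rightarrow> real \<Rightarrow> real" where
  "renewal_prob k t = prob {\<omega> \<in> space M. T k \<omega> \<le> t}"

definition renewal_fun :: "real \<Rightarrow> real" where
  "renewal_fun t = (\<Sum>k. renewal_prob k t)"

text \<open>Truncation controls the overshoot: the last interval starting before \<open>t\<close> contributes at most \<open>b\<close>.\<close>
lemma sum_truncated_le:
  assumes reg: "0 \<le> T0 \<omega> \<and> (\<forall>k. 0 < tau k \<omega>)" and "0 \<le> t" "0 \<le> b"
  shows "(\<Sum>k<n. min (tau k \<omega>) b * indicator {..t} (T k \<omega>)) \<le> min (T n \<omega>) (t + b)"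
proof (induction n)
  case 0
  then show ?case using assms by auto
next
  case (Suc n)
  have "0 < tau n \<omega>" using reg by blast
  then show ?case using Suc by (cases "T n \<omega> \<le> t") (auto simp: T_Suc min_def split: if_splits)
qed

lemma min_T_le_sum:
  assumes reg: "0 \<le> T0 \<omega> \<and> (\<forall>k. 0 < tau k \<omega>)"
  shows "min (T n \<omega>) t \<le> T0 \<omega> + (\<Sum>k<n. tau k \<omega> * indicator {..t} (T k \<omega>))"
proof (induction n)
  case (Suc n)
  have "0 < tau n \<omega>" using reg by blast
  then show ?case using Suc by (cases "T n \<omega> \<le> t") (auto simp: T_Suc min_def split: if_splits)
qed simp

lemma sum_renewal_prob_le:
  assumes "0 \<le> t" "0 \<le> b"
  shows "truncated_mean b * (\<Sum>k<n. renewal_prob k t) \<le> t + b"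
proof -
  note E = expectation_tau_indicator[of "\<lambda>x. min x b", OF _ integrable_min_tau[OF assms(2)], simplified]
  have "truncated_mean b * (\<Sum>k<n. renewal_prob k t) =
      (\<Sum>k<n. expectation (\<lambda>\<omega>. min (tau k \<omega>) b * indicator {..t} (T k \<omega>)))"
    by (simp add: E truncated_mean_def renewal_prob_def sum_distrib_left)
  also have "\<dots> = expectation (\<lambda>\<omega>. \<Sum>k<n. min (tau k \<omega>) b * indicator {..t} (T k \<omega>))"
    by (rule Bochner_Integration.integral_sum[symmetric]) (rule E)
  also have "\<dots> \<le> expectation (\<lambda>\<omega>. t + b)"
  proof (rule integral_mono_AE)
    show "integrable M (\<lambda>\<omega>. \<Sum>k<n. min (tau k \<omega>) b * indicator {..t} (T k \<omega>))"
      by (intro Bochner_Integration.integrable_sum E)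
    show "AE \<omega> in M. (\<Sum>k<n. min (tau k \<omega>) b * indicator {..t} (T k \<omega>)) \<le> t + b"
      using AE_regular by eventually_elim (use sum_truncated_le[OF _ assms] in force)
  qed simp
  finally show ?thesis by (simp add: prob_space)
qed

lemma renewal_prob_nonneg: "0 \<le> renewal_prob k t"
  by (simp add: renewal_prob_def)

lemma summable_renewal_prob:
  assumes "0 \<le> t"
  shows "summable (\<lambda>k. renewal_prob k t)"
proof (rule summableI_nonneg_bounded[where x="(t + 1) / truncated_mean 1"])
  show "(\<Sum>k<n. renewal_prob k t) \<le> (t + 1) / truncated_mean 1" for n
    using sum_renewal_prob_le[OF assms, of 1 n] truncated_mean_pos[of 1] by (simp add: field_simps)
qed (rule renewal_prob_nonneg)

lemma renewal_fun_le:
  assumes "0 \<le> t" "0 < b"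
  shows "renewal_fun t \<le> (t + b) / truncated_mean b"
  unfolding renewal_fun_def
proof (rule suminf_le_const[OF summable_renewal_prob[OF assms(1)]])
  show "(\<Sum>k<n. renewal_prob k t) \<le> (t + b) / truncated_mean b" for n
    using sum_renewal_prob_le[of t b n] truncated_mean_pos[of b] assms by (simp add: field_simps)
qed

lemma renewal_fun_ge:
  assumes "0 \<le> t" and T0: "integrable M T0"
  shows "(t - expectation T0) / mean \<le> renewal_fun t"
proof -
  note E = expectation_tau_indicator[of "\<lambda>x. x", OF _ integrable_tau, simplified, unfolded expectation_tau]
  have le: "t * (1 - renewal_prob n t) \<le> expectation T0 + mean * renewal_fun t" for n
  proof -
    have "t * (1 - renewal_prob n t) = expectation (\<lambda>\<omega>. t * indicator {\<omega> \<in> space M. \<not> T n \<omega> \<le> t} \<omega>)"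
      by (simp add: renewal_prob_def prob_neg)
    also have "\<dots> \<le> expectation (\<lambda>\<omega>. T0 \<omega> + (\<Sum>k<n. tau k \<omega> * indicator {..t} (T k \<omega>)))"
    proof (rule integral_mono_AE)
      show "integrable M (\<lambda>\<omega>. T0 \<omega> + (\<Sum>k<n. tau k \<omega> * indicator {..t} (T k \<omega>)))"
        by (intro Bochner_Integration.integrable_add Bochner_Integration.integrable_sum E T0)
      show "AE \<omega> in M. t * indicator {\<omega> \<in> space M. \<not> T n \<omega> \<le> t} \<omega>
          \<le> T0 \<omega> + (\<Sum>k<n. tau k \<omega> * indicator {..t} (T k \<omega>))"
        using AE_regular
      proof eventually_elim
        case (elim \<omega>)
        have "t * indicator {\<omega> \<in> space M. \<not> T n \<omega> \<le> t} \<omega> \<le> min (T n \<omega>) t"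
          using T_nonneg[OF elim, of n] \<open>0 \<le> t\<close> by (auto simp: indicator_def)
        with min_T_le_sum[OF elim, of n t] show ?case by linarith
      qed
      have "{\<omega> \<in> space M. \<not> T n \<omega> \<le> t} \<in> events" by measurable
      then show "integrable M (\<lambda>\<omega>. t * indicator {\<omega> \<in> space M. \<not> T n \<omega> \<le> t} \<omega>)"
        by (intro integrable_mult_right) (simp add: emeasure_eq_measure)
    qed
    also have "\<dots> = expectation T0 + mean * (\<Sum>k<n. renewal_prob k t)"
    proof (subst Bochner_Integration.integral_add[OF T0 Bochner_Integration.integrable_sum[OF E(1)]])
      show "expectation T0 + expectation (\<lambda>\<omega>. \<Sum>k<n. tau k \<omega> * indicator {..t} (T k \<omega>)) =
          expectation T0 + mean * (\<Sum>k<n. renewal_prob k t)"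
        by (subst Bochner_Integration.integral_sum[OF E(1)])
           (simp only: E(2) renewal_prob_def sum_distrib_left)
    qed
    also have "\<dots> \<le> expectation T0 + mean * renewal_fun t"
      unfolding renewal_fun_def
      by (intro add_left_mono mult_left_mono sum_le_suminf summable_renewal_prob assms)
         (use mean_pos renewal_prob_nonneg in auto)
    finally show ?thesis .
  qed
  have "(\<lambda>n. renewal_prob n t) \<longlonglongrightarrow> 0"
    using summable_renewal_prob[OF assms(1)] by (rule summable_LIMSEQ_zero)
  then have "(\<lambda>n. t * (1 - renewal_prob n t)) \<longlonglongrightarrow> t * (1 - 0)" by (intro tendsto_intros)
  then have "t * (1 - 0) \<le> expectation T0 + mean * renewal_fun t"
    by (rule LIMSEQ_le_const2) (use le in auto)
  then show ?thesis using mean_pos by (simp add: field_simps)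
qed

subsection \<open>Squared sojourn lengths\<close>

abbreviation L :: "real \<Rightarrow> nat \<Rightarrow> 'a \<Rightarrow> real" where
  "L t i \<omega> \<equiv> sojourn (\<lambda>k. T k \<omega>) t i"

definition sojourn_sq :: "real \<Rightarrow> nat \<Rightarrow> real" where
  "sojourn_sq t i = expectation (\<lambda>\<omega>. (L t i \<omega>)\<^sup>2)"

lemma measurable_reached [measurable]: "(\<lambda>\<omega>. reached (\<lambda>k. T k \<omega>) t i) \<in> borel_measurable M"
  by (induction i) simp_all

lemma measurable_L [measurable]: "L t i \<in> borel_measurable M"
  unfolding sojourn_def by measurable

lemma reached_eq:
  assumes reg: "0 \<le> T0 \<omega> \<and> (\<forall>k. 0 < tau k \<omega>)" and "0 \<le> t"
  shows "reached (\<lambda>k. T k \<omega>) t (Suc i) = min (T i \<omega>) t"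
proof (induction i)
  case 0
  then show ?case using assms by simp
next
  case (Suc i)
  have "0 < tau i \<omega>" using reg by blast
  then have "T i \<omega> \<le> T (Suc i) \<omega>" by (simp add: T_Suc)
  then have "min (T i \<omega>) t \<le> min (T (Suc i) \<omega>) t" by (auto simp: min_def)
  then show ?case using Suc by (simp only: reached.simps(2)[of _ _ "Suc i"] max_absorb2)
qed

lemma L_0:
  assumes "0 \<le> T0 \<omega> \<and> (\<forall>k. 0 < tau k \<omega>)" "0 \<le> t"
  shows "L t 0 \<omega> = min (T0 \<omega>) t"
  using reached_eq[OF assms, of 0] by (simp add: sojourn_def)

lemma L_Suc_bounds:
  assumes reg: "0 \<le> T0 \<omega> \<and> (\<forall>k. 0 < tau k \<omega>)" and "0 \<le> t"
  shows "L t (Suc k) \<omega> \<le> tau k \<omega> * indicator {..t} (T k \<omega>)"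
    and "0 \<le> a \<Longrightarrow> min (tau k \<omega>) a * indicator {..t - a} (T k \<omega>) \<le> L t (Suc k) \<omega>"
proof -
  have "0 < tau k \<omega>" using reg by blast
  moreover have "L t (Suc k) \<omega> = min (T (Suc k) \<omega>) t - min (T k \<omega>) t"
    unfolding sojourn_def reached_eq[OF assms] ..
  ultimately show "L t (Suc k) \<omega> \<le> tau k \<omega> * indicator {..t} (T k \<omega>)"
    and "0 \<le> a \<Longrightarrow> min (tau k \<omega>) a * indicator {..t - a} (T k \<omega>) \<le> L t (Suc k) \<omega>"
    by (auto simp: T_Suc indicator_def min_def)
qed

lemma integrable_L: "0 \<le> t \<Longrightarrow> integrable M (L t i)"
  by (rule integrable_const_bound[of _ t]) (auto simp: sojourn_nonneg sojourn_le)

lemma integrable_L_mult: "0 \<le> t \<Longrightarrow> integrable M (\<lambda>\<omega>. L t i \<omega> * L t j \<omega>)"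
  by (rule integrable_const_bound[of _ "t * t"])
     (auto simp: abs_mult sojourn_nonneg sojourn_le intro!: mult_mono)

lemma sojourn_sq_nonneg: "0 \<le> sojourn_sq t i"
  by (simp add: sojourn_sq_def)

lemma sojourn_sq_Suc_le:
  assumes "0 \<le> t"
  shows "sojourn_sq t (Suc k) \<le> second_moment * renewal_prob k t"
proof -
  note E = expectation_tau_indicator[of "\<lambda>x. x\<^sup>2", OF _ integrable_tau_sq, simplified, unfolded expectation_tau_sq]
  have "sojourn_sq t (Suc k) \<le> expectation (\<lambda>\<omega>. (tau k \<omega>)\<^sup>2 * indicator {..t} (T k \<omega>))"
    unfolding sojourn_sq_def
  proof (rule integral_mono_AE)
    show "integrable M (\<lambda>\<omega>. (L t (Suc k) \<omega>)\<^sup>2)"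
      using integrable_L_mult[OF assms] by (simp add: power2_eq_square)
    show "AE \<omega> in M. (L t (Suc k) \<omega>)\<^sup>2 \<le> (tau k \<omega>)\<^sup>2 * indicator {..t} (T k \<omega>)"
      using AE_regular
    proof eventually_elim
      case (elim \<omega>)
      have "(L t (Suc k) \<omega>)\<^sup>2 \<le> (tau k \<omega> * indicator {..t} (T k \<omega>))\<^sup>2"
        by (intro power_mono L_Suc_bounds elim assms sojourn_nonneg)
      then show ?case by (cases "T k \<omega> \<le> t") simp_all
    qed
  qed (rule E)
  then show ?thesis by (simp add: E renewal_prob_def)
qed

lemma sojourn_sq_Suc_ge:
  assumes "0 \<le> t" "0 \<le> a"
  shows "truncated_second_moment a * renewal_prob k (t - a) \<le> sojourn_sq t (Suc k)"
proof -
  note E = expectation_tau_indicator[of "\<lambda>x. (min x a)\<^sup>2", OF _ integrable_min_tau_sq[OF assms(2)], simplified]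
  have "expectation (\<lambda>\<omega>. (min (tau k \<omega>) a)\<^sup>2 * indicator {..t - a} (T k \<omega>)) \<le> sojourn_sq t (Suc k)"
    unfolding sojourn_sq_def
  proof (rule integral_mono_AE)
    show "integrable M (\<lambda>\<omega>. (L t (Suc k) \<omega>)\<^sup>2)"
      using integrable_L_mult[OF assms(1)] by (simp add: power2_eq_square)
    show "AE \<omega> in M. (min (tau k \<omega>) a)\<^sup>2 * indicator {..t - a} (T k \<omega>) \<le> (L t (Suc k) \<omega>)\<^sup>2"
      using AE_regular
    proof eventually_elim
      case (elim \<omega>)
      have "0 < tau k \<omega>" using elim by blast
      then have "(min (tau k \<omega>) a * indicator {..t - a} (T k \<omega>))\<^sup>2 \<le> (L t (Suc k) \<omega>)\<^sup>2"
        using assms(2) by (intro power_mono L_Suc_bounds elim assms) (auto simp: less_imp_le)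
      then show ?case by (cases "T k \<omega> \<le> t - a") simp_all
    qed
  qed (rule E)
  then show ?thesis by (simp add: E renewal_prob_def truncated_second_moment_def)
qed

lemma summable_sojourn_sq:
  assumes "0 \<le> t"
  shows "summable (sojourn_sq t)"
proof -
  have "summable (\<lambda>k. sojourn_sq t (Suc k))"
  proof (rule summable_comparison_test')
    show "summable (\<lambda>k. second_moment * renewal_prob k t)"
      by (intro summable_mult summable_renewal_prob assms)
    show "norm (sojourn_sq t (Suc k)) \<le> second_moment * renewal_prob k t" for k
      using sojourn_sq_Suc_le[OF assms] sojourn_sq_nonneg by simp
  qed
  then show ?thesis by (simp only: summable_Suc_iff)
qed

lemma suminf_sojourn_sq_le:
  assumes "0 \<le> t"
  shows "suminf (sojourn_sq t) \<le> expectation (\<lambda>\<omega>. (min (T0 \<omega>) t)\<^sup>2) + second_moment * renewal_fun t"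
proof -
  have "sojourn_sq t 0 = expectation (\<lambda>\<omega>. (min (T0 \<omega>) t)\<^sup>2)"
    unfolding sojourn_sq_def
  proof (rule integral_cong_AE)
    show "AE \<omega> in M. (L t 0 \<omega>)\<^sup>2 = (min (T0 \<omega>) t)\<^sup>2"
      using AE_regular by eventually_elim (simp add: L_0[OF _ assms])
  qed measurable
  moreover have "(\<Sum>k. sojourn_sq t (Suc k)) \<le> (\<Sum>k. second_moment * renewal_prob k t)"
    using summable_sojourn_sq[OF assms]
    by (intro suminf_le sojourn_sq_Suc_le assms summable_mult summable_renewal_prob)
       (simp only: summable_Suc_iff)
  moreover have "(\<Sum>k. second_moment * renewal_prob k t) = second_moment * renewal_fun t"
    unfolding renewal_fun_def by (rule suminf_mult[OF summable_renewal_prob[OF assms]])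
  ultimately show ?thesis using suminf_split_head[OF summable_sojourn_sq[OF assms]] by linarith
qed

lemma suminf_sojourn_sq_ge:
  assumes "0 \<le> a" "a \<le> t"
  shows "truncated_second_moment a * renewal_fun (t - a) \<le> suminf (sojourn_sq t)"
proof -
  have t: "0 \<le> t" "0 \<le> t - a" using assms by auto
  have "truncated_second_moment a * renewal_fun (t - a) = (\<Sum>k. truncated_second_moment a * renewal_prob k (t - a))"
    unfolding renewal_fun_def by (rule suminf_mult[OF summable_renewal_prob[OF t(2)], symmetric])
  also have "\<dots> \<le> (\<Sum>k. sojourn_sq t (Suc k))"
    using summable_sojourn_sq[OF t(1)]
    by (intro suminf_le sojourn_sq_Suc_ge t assms summable_mult summable_renewal_prob)
       (simp only: summable_Suc_iff)
  also have "\<dots> \<le> suminf (sojourn_sq t)"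
    using suminf_split_head[OF summable_sojourn_sq[OF t(1)]] sojourn_sq_nonneg[of t 0] by linarith
  finally show ?thesis .
qed

subsection \<open>Mean square displacement\<close>

lemma indep_times_velocities:
  fixes f :: "(nat option \<Rightarrow> real) \<Rightarrow> real" and g :: "(nat \<Rightarrow> 'v) \<Rightarrow> real"
  assumes f: "f \<in> borel_measurable (PiM UNIV (\<lambda>_. borel))" and g: "g \<in> borel_measurable (PiM UNIV (\<lambda>_. borel))"
  shows "indep_var borel (\<lambda>\<omega>. f (\<lambda>j. case j of None \<Rightarrow> T0 \<omega> | Some k \<Rightarrow> tau k \<omega>)) borel (\<lambda>\<omega>. g (\<lambda>k. V k \<omega>))"
proof -
  let ?X = "\<lambda>\<omega> j. case j of None \<Rightarrow> T0 \<omega> | Some k \<Rightarrow> tau k \<omega>"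
  let ?Y = "\<lambda>\<omega> i. V i \<omega>"
  let ?P = "PiM (UNIV :: nat option set) (\<lambda>_. borel :: real measure)"
  let ?Q = "PiM (UNIV :: nat set) (\<lambda>_. borel :: 'v measure)"
  have ind: "indep_set {?X -` A \<inter> space M | A. A \<in> sets ?P} {?Y -` B \<inter> space M | B. B \<in> sets ?Q}"
    using model by (simp add: renewal_model_def)
  have st: "Int_stable {Z -` A \<inter> space M | A. A \<in> sets N}" for Z :: "'a \<Rightarrow> real" and N
  proof (rule Int_stableI)
    fix a b assume "a \<in> {Z -` A \<inter> space M | A. A \<in> sets N}" "b \<in> {Z -` A \<inter> space M | A. A \<in> sets N}"
    then obtain A B where "a = Z -` A \<inter> space M" "b = Z -` B \<inter> space M" "A \<in> sets N" "B \<in> sets N" by blast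
    then have "a \<inter> b = Z -` (A \<inter> B) \<inter> space M" "A \<inter> B \<in> sets N" by auto
    then show "a \<inter> b \<in> {Z -` A \<inter> space M | A. A \<in> sets N}" by blast
  qed
  have [measurable]: "?X \<in> M \<rightarrow>\<^sub>M ?P"
  proof (rule measurable_PiM_single')
    show "(\<lambda>\<omega>. case j of None \<Rightarrow> T0 \<omega> | Some k \<Rightarrow> tau k \<omega>) \<in> borel_measurable M" for j
      by (cases j) auto
  qed auto
  have [measurable]: "?Y \<in> M \<rightarrow>\<^sub>M ?Q"
    by (rule measurable_PiM_single') auto
  let ?A = "{(\<lambda>\<omega>. f (?X \<omega>)) -` A \<inter> space M | A. A \<in> sets borel}"
  let ?B = "{(\<lambda>\<omega>. g (?Y \<omega>)) -` A \<inter> space M | A. A \<in> sets borel}"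
  have "?A \<subseteq> {?X -` A \<inter> space M | A. A \<in> sets ?P}"
  proof safe
    fix A :: "real set" assume "A \<in> sets borel"
    then have "f -` A \<in> sets ?P" using measurable_sets[OF f] by (simp add: space_PiM)
    then show "\<exists>A'. (\<lambda>\<omega>. f (?X \<omega>)) -` A \<inter> space M = ?X -` A' \<inter> space M \<and> A' \<in> sets ?P"
      by (intro exI[of _ "f -` A"]) auto
  qed
  moreover have "?B \<subseteq> {?Y -` A \<inter> space M | A. A \<in> sets ?Q}"
  proof safe
    fix A :: "real set" assume "A \<in> sets borel"
    then have "g -` A \<in> sets ?Q" using measurable_sets[OF g] by (simp add: space_PiM)
    then show "\<exists>A'. (\<lambda>\<omega>. g (?Y \<omega>)) -` A \<inter> space M = ?Y -` A' \<inter> space M \<and> A' \<in> sets ?Q"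
      by (intro exI[of _ "g -` A"]) auto
  qed
  ultimately have "indep_set ?A ?B"
    using ind unfolding indep_set_def
    by (elim indep_sets_mono_sets) (simp split: bool.split)
  moreover have "(\<lambda>\<omega>. f (?X \<omega>)) \<in> borel_measurable M" "(\<lambda>\<omega>. g (?Y \<omega>)) \<in> borel_measurable M"
    using f g by measurable
  ultimately show ?thesis
    unfolding indep_var_eq using indep_set_sigma_sets[OF _ st st] by blast
qed

definition path_times :: "(nat option \<Rightarrow> real) \<Rightarrow> nat \<Rightarrow> real" where
  "path_times y i = y None + (\<Sum>k<i. y (Some k))"

lemma measurable_path_sojourn:
  "(\<lambda>y. sojourn (path_times y) t i) \<in> borel_measurable (PiM UNIV (\<lambda>_. borel))"
proof -
  have [measurable]: "(\<lambda>y. path_times y i) \<in> borel_measurable (PiM UNIV (\<lambda>_. borel))" for i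
    unfolding path_times_def by measurable
  have [measurable]: "(\<lambda>y. reached (path_times y) t i) \<in> borel_measurable (PiM UNIV (\<lambda>_. borel))" for i
    by (induction i) simp_all
  show ?thesis unfolding sojourn_def by measurable
qed

lemma indep_L_V:
  fixes g :: "(nat \<Rightarrow> 'v) \<Rightarrow> real" and h :: "real \<Rightarrow> real \<Rightarrow> real"
  assumes g: "g \<in> borel_measurable (PiM UNIV (\<lambda>_. borel))"
    and h: "(\<lambda>(x, y). h x y) \<in> borel_measurable (borel \<Otimes>\<^sub>M borel)"
  shows "indep_var borel (\<lambda>\<omega>. h (L t i \<omega>) (L t j \<omega>)) borel (\<lambda>\<omega>. g (\<lambda>k. V k \<omega>))"
proof -
  note [measurable] = measurable_path_sojourn h
  let ?f = "\<lambda>y. h (sojourn (path_times y) t i) (sojourn (path_times y) t j)"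
  have "?f \<in> borel_measurable (PiM UNIV (\<lambda>_. borel))" by measurable
  from indep_times_velocities[OF this g]
  have "indep_var borel (\<lambda>\<omega>. ?f (\<lambda>j. case j of None \<Rightarrow> T0 \<omega> | Some k \<Rightarrow> tau k \<omega>)) borel (\<lambda>\<omega>. g (\<lambda>k. V k \<omega>))" .
  moreover have "path_times (\<lambda>j. case j of None \<Rightarrow> T0 \<omega> | Some k \<Rightarrow> tau k \<omega>) = (\<lambda>k. T k \<omega>)" for \<omega>
    by (simp add: path_times_def renewal_times_def fun_eq_iff)
  ultimately show ?thesis by simp
qed

lemma integrable_norm_V_sq: "integrable M (\<lambda>\<omega>. (norm (V i \<omega>))\<^sup>2)"
  and expectation_norm_V_sq: "expectation (\<lambda>\<omega>. (norm (V i \<omega>))\<^sup>2) = v\<^sup>2"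
  and integrable_V: "integrable M (V i)"
  and expectation_V: "expectation (V i) = 0"
  using model by (auto simp: renewal_model_def)

lemma expectation_V_inner:
  assumes "i \<noteq> j"
  shows "integrable M (\<lambda>\<omega>. V i \<omega> \<bullet> V j \<omega>)" "expectation (\<lambda>\<omega>. V i \<omega> \<bullet> V j \<omega>) = 0"
proof -
  have "indep_vars (\<lambda>_. borel) V UNIV" using model by (simp add: renewal_model_def)
  from indep_var_restrict[OF this, of "{i}" "{j}"] assms
  have *: "indep_var (PiM {i} (\<lambda>_. borel)) (\<lambda>\<omega>. restrict (\<lambda>i. V i \<omega>) {i})
                 (PiM {j} (\<lambda>_. borel)) (\<lambda>\<omega>. restrict (\<lambda>i. V i \<omega>) {j})" by auto
  have ind: "indep_var borel (\<lambda>\<omega>. V i \<omega> \<bullet> b) borel (\<lambda>\<omega>. V j \<omega> \<bullet> b)" for b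
    using indep_var_compose[OF *, of "\<lambda>f. f i \<bullet> b" borel "\<lambda>f. f j \<bullet> b" borel] by (simp add: comp_def)
  note int = integrable_inner_left[OF integrable_V]
  have eq: "V i \<omega> \<bullet> V j \<omega> = (\<Sum>b\<in>Basis. (V i \<omega> \<bullet> b) * (V j \<omega> \<bullet> b))" for \<omega>
    by (rule euclidean_inner)
  have I: "integrable M (\<lambda>\<omega>. (V i \<omega> \<bullet> b) * (V j \<omega> \<bullet> b))" for b
    using indep_var_integrable[OF ind int int] .
  show "integrable M (\<lambda>\<omega>. V i \<omega> \<bullet> V j \<omega>)" unfolding eq by (intro Bochner_Integration.integrable_sum I)
  have "expectation (\<lambda>\<omega>. (V i \<omega> \<bullet> b) * (V j \<omega> \<bullet> b)) = 0" for b
    using indep_var_lebesgue_integral[OF ind int int] integral_inner_left[OF integrable_V[of i], of b]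
    by (simp add: expectation_V)
  then show "expectation (\<lambda>\<omega>. V i \<omega> \<bullet> V j \<omega>) = 0"
    unfolding eq by (subst Bochner_Integration.integral_sum) (auto intro: I)
qed

lemma expectation_L_V_inner:
  assumes t: "0 \<le> t"
  shows "has_bochner_integral M (\<lambda>\<omega>. (L t i \<omega> * L t j \<omega>) * (V i \<omega> \<bullet> V j \<omega>))
    (if i = j then v\<^sup>2 * sojourn_sq t i else 0)"
proof -
  have ind: "indep_var borel (\<lambda>\<omega>. L t i \<omega> * L t j \<omega>) borel (\<lambda>\<omega>. V i \<omega> \<bullet> V j \<omega>)"
    by (rule indep_L_V[where h="(*)" and g="\<lambda>x. x i \<bullet> x j"]) measurable
  have int: "integrable M (\<lambda>\<omega>. V i \<omega> \<bullet> V j \<omega>)"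
    using expectation_V_inner(1)[of i j] integrable_norm_V_sq[of i]
    by (cases "i = j") (auto simp: power2_norm_eq_inner)
  have "expectation (\<lambda>\<omega>. V i \<omega> \<bullet> V j \<omega>) = (if i = j then v\<^sup>2 else 0)"
    using expectation_V_inner(2)[of i j] expectation_norm_V_sq[of i]
    by (auto simp: power2_norm_eq_inner)
  then show ?thesis
    using indep_var_lebesgue_integral[OF ind integrable_L_mult[OF t] int]
      indep_var_integrable[OF ind integrable_L_mult[OF t] int]
    by (auto simp: has_bochner_integral_iff sojourn_sq_def power2_eq_square[of "sojourn _ _ _"])
qed

definition partial_displacement :: "real \<Rightarrow> nat \<Rightarrow> 'a \<Rightarrow> 'v" where
  "partial_displacement t n \<omega> = (\<Sum>i<n. L t i \<omega> *\<^sub>R V i \<omega>)"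

lemma measurable_partial_displacement [measurable]: "partial_displacement t n \<in> borel_measurable M"
  unfolding partial_displacement_def by measurable

lemma expectation_partial_displacement:
  assumes t: "0 \<le> t"
  shows "expectation (\<lambda>\<omega>. (norm (partial_displacement t n \<omega>))\<^sup>2) = v\<^sup>2 * (\<Sum>i<n. sojourn_sq t i)"
proof -
  have "has_bochner_integral M (\<lambda>\<omega>. \<Sum>i<n. \<Sum>j<n. (L t i \<omega> * L t j \<omega>) * (V i \<omega> \<bullet> V j \<omega>))
      (\<Sum>i<n. \<Sum>j<n. if i = j then v\<^sup>2 * sojourn_sq t i else 0)"
    by (intro has_bochner_integral_sum expectation_L_V_inner t)
  moreover have "(norm (partial_displacement t n \<omega>))\<^sup>2 = (\<Sum>i<n. \<Sum>j<n. (L t i \<omega> * L t j \<omega>) * (V i \<omega> \<bullet> V j \<omega>))" for \<omega>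
    unfolding power2_norm_eq_inner partial_displacement_def inner_sum_left inner_sum_right
    by (subst sum.swap) (simp add: mult.assoc mult.left_commute)
  moreover have "(\<Sum>i<n. \<Sum>j<n. if i = j then v\<^sup>2 * sojourn_sq t i else 0) = v\<^sup>2 * (\<Sum>i<n. sojourn_sq t i)"
    by (simp add: sum_distrib_left)
  ultimately show ?thesis by (simp add: has_bochner_integral_iff)
qed

lemma displacement_eq:
  assumes "0 \<le> t"
  shows "displacement T0 tau V t \<omega> =
    (if Cauchy (\<lambda>n. partial_displacement t n \<omega>) then lim (\<lambda>n. partial_displacement t n \<omega>) else 0)"
proof -
  have "velocity T0 tau V \<omega> = step_path (\<lambda>k. T k \<omega>) (\<lambda>k. V k \<omega>)"
    by (simp add: velocity_def step_path_def fun_eq_iff)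
  then show ?thesis
    unfolding displacement_def partial_displacement_def
    using integral_step_path[OF assms, of "\<lambda>k. T k \<omega>" "\<lambda>k. V k \<omega>"] by (simp add: Cauchy_convergent_iff)
qed

lemma measurable_displacement:
  assumes "0 \<le> t"
  shows "displacement T0 tau V t \<in> borel_measurable M"
proof -
  have "(\<lambda>\<omega>. if Cauchy (\<lambda>n. partial_displacement t n \<omega>) then lim (\<lambda>n. partial_displacement t n \<omega>) else 0) \<in> borel_measurable M"
    by measurable
  then show ?thesis using displacement_eq[OF assms] by (simp cong: measurable_cong)
qed

lemma AE_exceeds:
  assumes "0 \<le> t"
  shows "AE \<omega> in M. \<exists>n. t < T n \<omega>"
proof -
  have "prob {\<omega> \<in> space M. \<forall>n. T n \<omega> \<le> t} \<le> renewal_prob n t" for n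
    unfolding renewal_prob_def by (rule finite_measure_mono) auto
  then have "prob {\<omega> \<in> space M. \<forall>n. T n \<omega> \<le> t} \<le> 0"
    using LIMSEQ_le_const[OF summable_LIMSEQ_zero[OF summable_renewal_prob[OF assms]]] by blast
  then have "prob {\<omega> \<in> space M. \<forall>n. T n \<omega> \<le> t} = 0" by (simp add: measure_le_0_iff)
  then have "AE \<omega> in M. \<not> (\<forall>n. T n \<omega> \<le> t)" by (subst (asm) prob_Collect_eq_0) auto
  then show ?thesis by (simp add: not_le)
qed

lemma AE_L_eventually_0:
  assumes t: "0 \<le> t"
  shows "AE \<omega> in M. \<exists>N. \<forall>i\<ge>N. L t i \<omega> = 0"
  using AE_exceeds[OF t]
proof eventually_elim
  case (elim \<omega>)
  then obtain n where n: "t < T n \<omega>" by blast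
  have "reached (\<lambda>k. T k \<omega>) t i = t" if "Suc n \<le> i" for i
    using min_le_reached[of n i "\<lambda>k. T k \<omega>" t] reached_le[OF t, of "\<lambda>k. T k \<omega>" i] that n by simp
  then have "\<forall>i\<ge>Suc n. L t i \<omega> = 0" by (simp add: sojourn_def del: reached.simps)
  then show ?case by blast
qed

lemma AE_partial_displacement_tendsto:
  assumes t: "0 \<le> t"
  shows "AE \<omega> in M. (\<lambda>n. partial_displacement t n \<omega>) \<longlonglongrightarrow> displacement T0 tau V t \<omega>"
  using AE_L_eventually_0[OF t]
proof eventually_elim
  case (elim \<omega>)
  then obtain N where N: "\<And>i. i \<ge> N \<Longrightarrow> L t i \<omega> = 0" by blast
  have "(\<lambda>i. L t i \<omega> *\<^sub>R V i \<omega>) sums (\<Sum>i<N. L t i \<omega> *\<^sub>R V i \<omega>)"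
    by (rule sums_finite) (use N in \<open>auto simp: not_less\<close>)
  then have "convergent (\<lambda>n. partial_displacement t n \<omega>)"
    unfolding sums_def partial_displacement_def by (rule convergentI)
  then show ?case
    unfolding displacement_eq[OF t] by (simp add: convergent_LIMSEQ_iff Cauchy_convergent_iff)
qed

lemma norm_partial_displacement_le:
  assumes t: "0 \<le> t"
  shows "(norm (partial_displacement t n \<omega>))\<^sup>2 \<le> t * (\<Sum>i<n. L t i \<omega> * (norm (V i \<omega>))\<^sup>2)"
proof -
  have "norm (partial_displacement t n \<omega>) \<le> (\<Sum>i<n. sqrt (L t i \<omega>) * (sqrt (L t i \<omega>) * norm (V i \<omega>)))"
    unfolding partial_displacement_def
    by (rule order_trans[OF norm_sum]) (simp add: sojourn_nonneg mult.assoc[symmetric])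
  then have "(norm (partial_displacement t n \<omega>))\<^sup>2 \<le> (\<Sum>i<n. sqrt (L t i \<omega>) * (sqrt (L t i \<omega>) * norm (V i \<omega>)))\<^sup>2"
    by (intro power_mono) auto
  also have "\<dots> \<le> (\<Sum>i<n. (sqrt (L t i \<omega>))\<^sup>2) * (\<Sum>i<n. (sqrt (L t i \<omega>) * norm (V i \<omega>))\<^sup>2)"
    by (rule Cauchy_Schwarz_ineq_sum)
  also have "\<dots> = reached (\<lambda>k. T k \<omega>) t n * (\<Sum>i<n. L t i \<omega> * (norm (V i \<omega>))\<^sup>2)"
    by (simp add: power_mult_distrib sojourn_nonneg sum_sojourn)
  also have "\<dots> \<le> t * (\<Sum>i<n. L t i \<omega> * (norm (V i \<omega>))\<^sup>2)"
    by (intro mult_right_mono reached_le t sum_nonneg) (auto simp: sojourn_nonneg)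
  finally show ?thesis .
qed

lemma expectation_L_norm_V:
  assumes t: "0 \<le> t"
  shows "has_bochner_integral M (\<lambda>\<omega>. L t i \<omega> * (norm (V i \<omega>))\<^sup>2) (expectation (L t i) * v\<^sup>2)"
proof -
  have ind: "indep_var borel (\<lambda>\<omega>. L t i \<omega>) borel (\<lambda>\<omega>. (norm (V i \<omega>))\<^sup>2)"
    by (rule indep_L_V[where h="\<lambda>x y. x" and g="\<lambda>x. (norm (x i))\<^sup>2"]) measurable
  show ?thesis
    using indep_var_lebesgue_integral[OF ind integrable_L[OF t] integrable_norm_V_sq]
      indep_var_integrable[OF ind integrable_L[OF t] integrable_norm_V_sq]
    by (simp add: has_bochner_integral_iff expectation_norm_V_sq)
qed

lemma msd_eq:
  assumes t: "0 \<le> t"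
  shows "msd M T0 tau V t = v\<^sup>2 * suminf (sojourn_sq t)"
proof -
  let ?w = "\<lambda>i \<omega>. L t i \<omega> * (norm (V i \<omega>))\<^sup>2"
  have w0: "0 \<le> ?w i \<omega>" for i \<omega> by (simp add: sojourn_nonneg)
  have sw: "AE \<omega> in M. summable (\<lambda>i. ?w i \<omega>)"
    using AE_L_eventually_0[OF t]
  proof eventually_elim
    case (elim \<omega>)
    then obtain N where N: "\<And>i. i \<ge> N \<Longrightarrow> L t i \<omega> = 0" by blast
    show ?case by (rule summable_finite[of "{..<N}"]) (use N in \<open>auto simp: not_less\<close>)
  qed
  have W: "integrable M (\<lambda>\<omega>. \<Sum>i. ?w i \<omega>)"
  proof (rule integrable_suminf)
    show "integrable M (?w i)" for i using expectation_L_norm_V[OF t] by (simp add: has_bochner_integral_iff)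
    show "AE \<omega> in M. summable (\<lambda>i. norm (?w i \<omega>))" using sw w0 by simp
    have "summable (\<lambda>i. expectation (L t i) * v\<^sup>2)"
    proof (intro summable_mult2 summableI_nonneg_bounded[where x=t])
      show "0 \<le> expectation (L t i)" for i by (simp add: sojourn_nonneg)
      fix n
      have "(\<Sum>i<n. expectation (L t i)) = expectation (\<lambda>\<omega>. reached (\<lambda>k. T k \<omega>) t n)"
        by (subst Bochner_Integration.integral_sum[symmetric]) (auto intro: integrable_L t simp: sum_sojourn)
      also have "\<dots> \<le> expectation (\<lambda>_. t)"
      proof (rule integral_mono)
        show "integrable M (\<lambda>\<omega>. reached (\<lambda>k. T k \<omega>) t n)"
          by (rule integrable_const_bound[of _ t]) (auto simp: reached_nonneg reached_le t)
      qed (auto simp: reached_le t)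
      finally show "(\<Sum>i<n. expectation (L t i)) \<le> t" by (simp add: prob_space)
    qed
    then show "summable (\<lambda>i. expectation (\<lambda>\<omega>. norm (?w i \<omega>)))"
      using expectation_L_norm_V[OF t] w0 by (simp add: has_bochner_integral_iff)
  qed
  have "(\<lambda>n. expectation (\<lambda>\<omega>. (norm (partial_displacement t n \<omega>))\<^sup>2)) \<longlonglongrightarrow>
      expectation (\<lambda>\<omega>. (norm (displacement T0 tau V t \<omega>))\<^sup>2)"
  proof (rule integral_dominated_convergence[where w="\<lambda>\<omega>. t * (\<Sum>i. ?w i \<omega>)"])
    show "(\<lambda>\<omega>. (norm (displacement T0 tau V t \<omega>))\<^sup>2) \<in> borel_measurable M"
      using measurable_displacement[OF t] by measurable
    show "integrable M (\<lambda>\<omega>. t * (\<Sum>i. ?w i \<omega>))" using W by simp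
    show "AE \<omega> in M. (\<lambda>n. (norm (partial_displacement t n \<omega>))\<^sup>2) \<longlonglongrightarrow> (norm (displacement T0 tau V t \<omega>))\<^sup>2"
      using AE_partial_displacement_tendsto[OF t] by eventually_elim (intro tendsto_intros)
    fix n
    show "AE \<omega> in M. norm ((norm (partial_displacement t n \<omega>))\<^sup>2) \<le> t * (\<Sum>i. ?w i \<omega>)"
      using sw
    proof eventually_elim
      case (elim \<omega>)
      have "(norm (partial_displacement t n \<omega>))\<^sup>2 \<le> t * (\<Sum>i<n. ?w i \<omega>)"
        by (rule norm_partial_displacement_le[OF t])
      also have "\<dots> \<le> t * (\<Sum>i. ?w i \<omega>)"
        by (intro mult_left_mono sum_le_suminf elim t) (auto simp: w0)
      finally show ?case by simp
    qed
  qed measurable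
  moreover have "(\<lambda>n. v\<^sup>2 * (\<Sum>i<n. sojourn_sq t i)) \<longlonglongrightarrow> v\<^sup>2 * suminf (sojourn_sq t)"
    by (intro tendsto_intros summable_LIMSEQ summable_sojourn_sq t)
  ultimately show ?thesis
    unfolding msd_def expectation_partial_displacement[OF t] by (rule LIMSEQ_unique)
qed

lemma expectation_min_T0_sq_tendsto:
  assumes T0: "integrable M T0"
  shows "((\<lambda>t. expectation (\<lambda>\<omega>. (min (T0 \<omega>) t)\<^sup>2) / t) \<longlongrightarrow> 0) at_top"
proof -
  have "((\<lambda>t. expectation (\<lambda>\<omega>. (min (T0 \<omega>) t)\<^sup>2 / t)) \<longlongrightarrow> expectation (\<lambda>_. 0)) at_top"
  proof (rule integral_dominated_convergence_at_top[where w=T0])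
    show "\<forall>\<^sub>F t in at_top. AE \<omega> in M. norm ((min (T0 \<omega>) t)\<^sup>2 / t) \<le> T0 \<omega>"
      using eventually_gt_at_top[of 0]
    proof eventually_elim
      case (elim t)
      show ?case using AE_T0_nonneg
      proof eventually_elim
        case (elim \<omega>)
        have "(min (T0 \<omega>) t)\<^sup>2 \<le> T0 \<omega> * t"
          unfolding power2_eq_square using elim \<open>0 < t\<close> by (intro mult_mono) auto
        then show ?case using \<open>0 < t\<close> by (simp add: field_simps)
      qed
    qed
    show "AE \<omega> in M. ((\<lambda>t. (min (T0 \<omega>) t)\<^sup>2 / t) \<longlongrightarrow> 0) at_top"
    proof (rule AE_I2)
      fix \<omega>
      have "((\<lambda>t. (T0 \<omega>)\<^sup>2 / t) \<longlongrightarrow> 0) at_top" by (rule tendsto_divide_0[OF tendsto_const filterlim_at_top_imp_at_infinity[OF filterlim_ident]])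
      then show "((\<lambda>t. (min (T0 \<omega>) t)\<^sup>2 / t) \<longlongrightarrow> 0) at_top"
        by (rule Lim_transform_eventually)
           (use eventually_ge_at_top[of "T0 \<omega>"] in \<open>eventually_elim, simp add: min_def\<close>)
    qed
  qed (use T0 in auto)
  then show ?thesis by simp
qed

lemma msd_div_tendsto:
  assumes T0: "integrable M T0"
  shows "((\<lambda>t. msd M T0 tau V t / t) \<longlongrightarrow> v\<^sup>2 * (second_moment / mean)) at_top"
proof -
  have "((\<lambda>t. suminf (sojourn_sq t) / t) \<longlongrightarrow> second_moment / mean) at_top"
  proof (rule order_tendstoI)
    fix l assume l: "l < second_moment / mean"
    have "(\<lambda>n. truncated_second_moment (real n) / mean) \<longlonglongrightarrow> second_moment / mean"
      using mean_pos by (intro tendsto_intros truncated_second_moment_tendsto) auto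
    from order_tendstoD(1)[OF this l] obtain n where n: "l < truncated_second_moment (real n) / mean"
      by (auto simp: eventually_sequentially)
    let ?a = "real n" and ?g = "truncated_second_moment (real n)"
    have "((\<lambda>t. ?g / mean * (1 - (?a + expectation T0) / t)) \<longlongrightarrow> ?g / mean * (1 - 0)) at_top"
      by (intro tendsto_intros tendsto_divide_0[OF tendsto_const filterlim_at_top_imp_at_infinity[OF filterlim_ident]])
    then have "\<forall>\<^sub>F t in at_top. l < ?g / mean * (1 - (?a + expectation T0) / t)"
      using n by (intro order_tendstoD(1)) auto
    then show "\<forall>\<^sub>F t in at_top. l < suminf (sojourn_sq t) / t"
      using eventually_ge_at_top[of ?a] eventually_gt_at_top[of 0]
    proof eventually_elim
      case (elim t)
      have "?g * ((t - ?a - expectation T0) / mean) \<le> ?g * renewal_fun (t - ?a)"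
        using elim by (intro mult_left_mono renewal_fun_ge truncated_second_moment_nonneg T0) auto
      also have "\<dots> \<le> suminf (sojourn_sq t)" using elim by (intro suminf_sojourn_sq_ge) auto
      finally have "?g * ((t - ?a - expectation T0) / mean) / t \<le> suminf (sojourn_sq t) / t"
        using elim by (intro divide_right_mono) auto
      moreover have "?g * ((t - ?a - expectation T0) / mean) / t = ?g / mean * (1 - (?a + expectation T0) / t)"
        using elim mean_pos by (simp add: field_simps)
      ultimately show ?case using elim by linarith
    qed
  next
    fix u assume u: "second_moment / mean < u"
    have "(\<lambda>n. second_moment / truncated_mean (real n)) \<longlonglongrightarrow> second_moment / mean"
      using mean_pos by (intro tendsto_intros truncated_mean_tendsto) auto
    from order_tendstoD(2)[OF this u] eventually_gt_at_top[of 0]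
    have "\<forall>\<^sub>F n in sequentially. 0 < n \<and> second_moment / truncated_mean (real n) < u"
      by eventually_elim simp
    then obtain n where n: "0 < n" "second_moment / truncated_mean (real n) < u"
      by (auto simp: eventually_sequentially)
    let ?b = "real n" and ?m = "truncated_mean (real n)"
    let ?e = "\<lambda>t. expectation (\<lambda>\<omega>. (min (T0 \<omega>) t)\<^sup>2) / t"
    have "((\<lambda>t. ?e t + second_moment / ?m * (1 + ?b / t)) \<longlongrightarrow> 0 + second_moment / ?m * (1 + 0)) at_top"
      by (intro tendsto_intros expectation_min_T0_sq_tendsto T0
          tendsto_divide_0[OF tendsto_const filterlim_at_top_imp_at_infinity[OF filterlim_ident]])
    then have "\<forall>\<^sub>F t in at_top. ?e t + second_moment / ?m * (1 + ?b / t) < u"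
      using n by (intro order_tendstoD(2)) auto
    then show "\<forall>\<^sub>F t in at_top. suminf (sojourn_sq t) / t < u"
      using eventually_gt_at_top[of 0]
    proof eventually_elim
      case (elim t)
      have m: "0 < ?m" using n by (intro truncated_mean_pos) auto
      have "suminf (sojourn_sq t) \<le> expectation (\<lambda>\<omega>. (min (T0 \<omega>) t)\<^sup>2) + second_moment * renewal_fun t"
        using elim by (intro suminf_sojourn_sq_le) auto
      also have "\<dots> \<le> expectation (\<lambda>\<omega>. (min (T0 \<omega>) t)\<^sup>2) + second_moment * ((t + ?b) / ?m)"
        using elim n second_moment_pos by (intro add_left_mono mult_left_mono renewal_fun_le) auto
      finally have "suminf (sojourn_sq t) / t \<le> (expectation (\<lambda>\<omega>. (min (T0 \<omega>) t)\<^sup>2) + second_moment * ((t + ?b) / ?m)) / t"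
        using elim by (intro divide_right_mono) auto
      also have "\<dots> = ?e t + second_moment / ?m * (1 + ?b / t)"
        using elim m by (simp add: add_divide_distrib distrib_left)
      finally show ?case using elim by linarith
    qed
  qed
  then have "((\<lambda>t. v\<^sup>2 * (suminf (sojourn_sq t) / t)) \<longlongrightarrow> v\<^sup>2 * (second_moment / mean)) at_top"
    by (rule tendsto_mult_left)
  then show ?thesis
    by (rule Lim_transform_eventually) (use eventually_ge_at_top[of 0] in \<open>eventually_elim, simp add: msd_eq\<close>)
qed

lemma msd_asymp_equiv:
  assumes "integrable M T0" "v > 0"
  shows "msd M T0 tau V \<sim>[at_top]
    (\<lambda>t. (LBINT s:{0..}. 2 * s * (1 - F s)) * v\<^sup>2 * t / (LBINT s:{0..}. 1 - F s))"
proof (rule asymp_equivI')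
  let ?c = "v\<^sup>2 * (second_moment / mean)"
  have c: "?c \<noteq> 0" using assms mean_pos second_moment_pos by simp
  have "((\<lambda>t. msd M T0 tau V t / t / ?c) \<longlongrightarrow> ?c / ?c) at_top"
    using c by (intro tendsto_divide msd_div_tendsto assms tendsto_const)
  moreover have "msd M T0 tau V t / t / ?c =
      msd M T0 tau V t / ((LBINT s:{0..}. 2 * s * (1 - F s)) * v\<^sup>2 * t / (LBINT s:{0..}. 1 - F s))" for t
    by (simp add: second_moment_def mean_def)
  ultimately show "((\<lambda>t. msd M T0 tau V t / ((LBINT s:{0..}. 2 * s * (1 - F s)) * v\<^sup>2 * t / (LBINT s:{0..}. 1 - F s))) \<longlongrightarrow> 1) at_top"
    using c by simp
qed

text \<open>By Tonelli: the equilibrium delay has tail \<open>\<integral>\<^sub>x\<^sup>\<infinity> (1 - F) / mean\<close>, so its mean is half the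
  second moment divided by the mean.\<close>
lemma integrable_equilibrium_delay:
  assumes eq: "\<And>x. 0 \<le> x \<Longrightarrow> prob {\<omega> \<in> space M. T0 \<omega> \<le> x} = (LBINT s:{0..x}. 1 - F s) / (LBINT s:{0..}. 1 - F s)"
  shows "integrable M T0"
proof (rule integrableI_nonneg)
  have F1: "F s \<le> 1" for s unfolding prob_tau_le[of 0, symmetric] by simp
  define G where "G s = indicator {0..} s * (1 - F s)" for s :: real
  have [measurable]: "G \<in> borel_measurable borel"
    using mean_fin unfolding G_def by (auto simp: set_integrable_def dest: borel_measurable_integrable)
  let ?f = "\<lambda>x s. if 0 \<le> x \<and> x < s then ennreal (G s) else 0"
  have tail: "ennreal (indicator {0..} x * (1 * (1 - prob {\<omega> \<in> space M. T0 \<omega> \<le> x}))) \<le> ennreal (1 / mean) * (\<integral>\<^sup>+s. ?f x s \<partial>lborel)" for x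
  proof (cases "0 \<le> x")
    case True
    have "mean = (LBINT s:{0..x} \<union> {x<..}. 1 - F s)"
      unfolding mean_def using True by (intro arg_cong2[where f="set_lebesgue_integral lborel"]) auto
    also have "\<dots> = (LBINT s:{0..x}. 1 - F s) + (LBINT s:{x<..}. 1 - F s)"
      by (rule set_integral_Un) (use True in \<open>auto intro!: set_integrable_subset[OF mean_fin]\<close>)
    finally have "1 - prob {\<omega> \<in> space M. T0 \<omega> \<le> x} = 1 / mean * (LBINT s:{x<..}. 1 - F s)"
      using mean_pos unfolding eq[OF True] mean_def[symmetric] by (simp add: field_simps)
    then have "ennreal (indicator {0..} x * (1 * (1 - prob {\<omega> \<in> space M. T0 \<omega> \<le> x}))) = ennreal (1 / mean) * ennreal (LBINT s:{x<..}. 1 - F s)"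
      using True mean_pos ennreal_mult'[of "1 / mean" "LBINT s:{x<..}. 1 - F s"] by simp
    also have "ennreal (LBINT s:{x<..}. 1 - F s) = (\<integral>\<^sup>+s. ennreal (indicator {x<..} s *\<^sub>R (1 - F s)) \<partial>lborel)"
      unfolding set_lebesgue_integral_def
    proof (rule nn_integral_eq_integral[symmetric])
      have "set_integrable lborel {x<..} (\<lambda>s. 1 - F s)"
        using True by (intro set_integrable_subset[OF mean_fin]) auto
      then show "integrable lborel (\<lambda>s. indicator {x<..} s *\<^sub>R (1 - F s))" by (simp add: set_integrable_def)
    qed (use F1 in \<open>auto simp: indicator_def\<close>)
    also have "\<dots> = (\<integral>\<^sup>+s. ?f x s \<partial>lborel)"
      using True by (intro nn_integral_cong) (auto simp: indicator_def G_def)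
    finally show ?thesis by simp
  qed simp
  have nn0: "AE \<omega> in M. 0 \<le> T0 \<omega>" by (rule AE_T0_nonneg)
  have "(\<integral>\<^sup>+\<omega>. ennreal (T0 \<omega>) \<partial>M) = (\<integral>\<^sup>+x. ennreal (indicator {0..} x * (1 * (1 - prob {\<omega> \<in> space M. T0 \<omega> \<le> x}))) \<partial>lborel)"
    by (rule nn_integral_tail) (auto intro: nn0)
  also have "\<dots> \<le> (\<integral>\<^sup>+x. ennreal (1 / mean) * (\<integral>\<^sup>+s. ?f x s \<partial>lborel) \<partial>lborel)"
    by (intro nn_integral_mono tail)
  also have "\<dots> = ennreal (1 / mean) * (\<integral>\<^sup>+x. (\<integral>\<^sup>+s. ?f x s \<partial>lborel) \<partial>lborel)"
    by (intro nn_integral_cmult) measurable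
  also have "(\<integral>\<^sup>+x. (\<integral>\<^sup>+s. ?f x s \<partial>lborel) \<partial>lborel) = (\<integral>\<^sup>+s. (\<integral>\<^sup>+x. ?f x s \<partial>lborel) \<partial>lborel)"
    by (intro lborel_pair.Fubini'[symmetric]) measurable
  also have "\<dots> = (\<integral>\<^sup>+s. ennreal (indicator {0..} s *\<^sub>R (s * (1 - F s))) \<partial>lborel)"
  proof (rule nn_integral_cong)
    fix s :: real
    have "(\<integral>\<^sup>+x. ?f x s \<partial>lborel) = (\<integral>\<^sup>+x. ennreal (G s) * indicator {0..<s} x \<partial>lborel)"
      by (intro nn_integral_cong) (auto simp: indicator_def)
    also have "\<dots> = ennreal (G s) * emeasure lborel {0..<s}"
      by (rule nn_integral_cmult_indicator) simp
    also have "\<dots> = ennreal (indicator {0..} s *\<^sub>R (s * (1 - F s)))"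
      by (cases "0 \<le> s") (auto simp: ennreal_mult[symmetric] F1 mult.commute G_def)
    finally show "(\<integral>\<^sup>+x. ?f x s \<partial>lborel) = ennreal (indicator {0..} s *\<^sub>R (s * (1 - F s)))" .
  qed
  also have "\<dots> < \<infinity>"
  proof -
    have "integrable lborel (\<lambda>s. 1/2 * (indicator {0..} s *\<^sub>R (2 * s * (1 - F s))))"
      using second_fin unfolding set_integrable_def by (rule integrable_mult_right)
    then have "integrable lborel (\<lambda>s. indicator {0..} s *\<^sub>R (s * (1 - F s)))" by (simp add: mult.assoc)
    then show ?thesis
      by (subst nn_integral_eq_integral) (auto simp: indicator_def F1)
  qed
  then have "ennreal (1 / mean) * (\<integral>\<^sup>+s. ennreal (indicator {0..} s *\<^sub>R (s * (1 - F s))) \<partial>lborel) < \<infinity>"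
    by (simp add: ennreal_mult_less_top)
  finally show "(\<integral>\<^sup>+\<omega>. ennreal (T0 \<omega>) \<partial>M) < \<infinity>" .
qed (auto intro: AE_T0_nonneg)

end

theorem theorem8p2:
  fixes F :: "real \<Rightarrow> real" and v :: real
    and Mt :: "'a measure" and tau :: "nat \<Rightarrow> 'a \<Rightarrow> real" and V :: "nat \<Rightarrow> 'a \<Rightarrow> real ^ 'd"
    and Me :: "'b measure" and T0' :: "'b \<Rightarrow> real" and tau' :: "nat \<Rightarrow> 'b \<Rightarrow> real"
    and V' :: "nat \<Rightarrow> 'b \<Rightarrow> real ^ 'd"
  assumes F_cont: "continuous_on UNIV F"
    and F_pos: "F 0 = 0"
    and mean_fin: "set_integrable lborel {0..} (\<lambda>s. 1 - F s)"
    and second_fin: "set_integrable lborel {0..} (\<lambda>s. 2 * s * (1 - F s))"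
    and v_pos: "v > 0"
    and tr: "renewal_model Mt F (\<lambda>_. 0) tau V v"
    and eq: "renewal_model Me F T0' tau' V' v"
    and eq_T0: "\<And>x. x \<ge> 0 \<Longrightarrow> measure Me {\<omega> \<in> space Me. T0' \<omega> \<le> x} =
                  (LBINT s:{0..x}. 1 - F s) / (LBINT s:{0..}. 1 - F s)"
  shows "msd Mt (\<lambda>_. 0) tau V \<sim>[at_top]
           (\<lambda>t. (LBINT s:{0..}. 2 * s * (1 - F s)) * v\<^sup>2 * t / (LBINT s:{0..}. 1 - F s)) \<and>
         msd Me T0' tau' V' \<sim>[at_top]
           (\<lambda>t. (LBINT s:{0..}. 2 * s * (1 - F s)) * v\<^sup>2 * t / (LBINT s:{0..}. 1 - F s))"
proof
  interpret tr: renewal_process Mt F "\<lambda>_. 0" tau V v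
    by unfold_locales (fact tr F_pos mean_fin second_fin)+
  interpret eq: renewal_process Me F T0' tau' V' v
    by unfold_locales (fact eq F_pos mean_fin second_fin)+
  show "msd Mt (\<lambda>_. 0) tau V \<sim>[at_top]
      (\<lambda>t. (LBINT s:{0..}. 2 * s * (1 - F s)) * v\<^sup>2 * t / (LBINT s:{0..}. 1 - F s))"
    by (rule tr.msd_asymp_equiv[OF _ v_pos]) simp
  show "msd Me T0' tau' V' \<sim>[at_top]
      (\<lambda>t. (LBINT s:{0..}. 2 * s * (1 - F s)) * v\<^sup>2 * t / (LBINT s:{0..}. 1 - F s))"
    by (rule eq.msd_asymp_equiv[OF eq.integrable_equilibrium_delay[OF eq_T0] v_pos])
qed

end
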